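(* For every finite set $\mathcal{C}$ of constraints, $\mathrm{EQUIV}_c(\mathcal{C})$ is (polynomial-time) truth-table reducible to $\mathrm{CSP}_c(\mathcal{C})$.
   Context: A constraint of arity $k$ is a Boolean function $C:\{0,1\}^k\to\{0,1\}$. If for $1\le i\le k$ each $x_i$ is a variable or a constant $0$ or $1$, then $C(x_1,\dots,x_k)$ is a constraint application of $C$ with constants. A set of constraint applications is interpreted as the conjunction of its members. For a fixed finite set $\mathcal{C}$ of constraints: $\mathrm{CSP}_c(\mathcal{C})$ is the problem of deciding, given a set $S$ of constraint applications of constraints from $\mathcal{C}$ with constants, whether there is an assignment to the variables satisfying every constraint application in $S$. $\mathrm{EQUIV}_c(\mathcal{C})$ is the problem of deciding, given two such sets $S$ and $U$, whether they are equivalent, i.e., for every assignment to the variables, $S$ is satisfied iff $U$ is satisfied. *)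

theory Defs
  imports "HOL-Computational_Algebra.Polynomial"
begin

section \<open>Multi-tape Turing machines and polynomial time\<close>

text \<open>
  Tape symbols over a set of letters of type \<open>'a\<close>. \<open>Sep\<close> and \<open>Bit\<close> serve to write lists of
  words and truth values on a tape; \<open>Work i\<close> are auxiliary symbols private to a machine. A machine
  uses only finitely many symbols, see \<open>wf_tm\<close>.
\<close>

datatype 'a symbol = Blank | Letter 'a | Sep | Bit bool | Work nat

text \<open>
  \<open>Tape l r\<close> is a two-way infinite tape: \<open>r\<close> is its content from the head position to the right,
  \<open>l\<close> its content to the left of the head in reverse order. All cells not listed are blank.
\<close>

datatype 'a tape = Tape "'a symbol list" "'a symbol list"

datatype direction = GoLeft | Stay | GoRight

fun tape_read :: "'a tape \<Rightarrow> 'a symbol" where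
  "tape_read (Tape l []) = Blank"
| "tape_read (Tape l (s # r)) = s"

fun tape_write :: "'a symbol \<Rightarrow> 'a tape \<Rightarrow> 'a tape" where
  "tape_write s (Tape l r) = Tape l (s # tl r)"

fun tape_move :: "direction \<Rightarrow> 'a tape \<Rightarrow> 'a tape" where
  "tape_move Stay t = t"
| "tape_move GoLeft (Tape [] r) = Tape [] (Blank # r)"
| "tape_move GoLeft (Tape (s # l) r) = Tape l (s # r)"
| "tape_move GoRight (Tape l []) = Tape (Blank # l) []"
| "tape_move GoRight (Tape l (s # r)) = Tape (s # l) r"

record 'a tm =
  num_tapes :: nat
  states :: "nat set"
  start :: nat
  halt :: nat
  symbols :: "'a symbol set"
  trans :: "nat \<Rightarrow> 'a symbol list \<Rightarrow> nat \<times> ('a symbol \<times> direction) list"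

text \<open>
  \<open>trans\<close> is a total HOL function, but only its restriction to the finitely many pairs of a state
  and a vector of \<open>num_tapes\<close> tape symbols of the machine matters.
\<close>

definition wf_tm :: "'a tm \<Rightarrow> bool" where
  "wf_tm M \<longleftrightarrow>
     num_tapes M \<ge> 1 \<and>
     finite (states M) \<and> start M \<in> states M \<and> halt M \<in> states M \<and>
     finite (symbols M) \<and> Blank \<in> symbols M \<and>
     (\<forall>q \<in> states M. \<forall>ss \<in> lists (symbols M). length ss = num_tapes M \<longrightarrow>
        fst (trans M q ss) \<in> states M \<and>
        length (snd (trans M q ss)) = num_tapes M \<and>
        fst ` set (snd (trans M q ss)) \<subseteq> symbols M)"

type_synonym 'a config = "nat \<times> 'a tape list"

definition tm_step :: "'a tm \<Rightarrow> 'a config \<Rightarrow> 'a config" where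
  "tm_step M = (\<lambda>(q, ts).
     if q = halt M then (q, ts)
     else let (q', acts) = trans M q (map tape_read ts)
          in (q', map2 (\<lambda>(s, d) t. tape_move d (tape_write s t)) acts ts))"

definition tm_init :: "'a tm \<Rightarrow> 'a symbol list \<Rightarrow> 'a config" where
  "tm_init M w = (start M, Tape [] w # replicate (num_tapes M - 1) (Tape [] []))"

text \<open>The output is the word on the first tape from the head up to the next blank.\<close>

fun tape_output :: "'a tape \<Rightarrow> 'a symbol list" where
  "tape_output (Tape l r) = takeWhile (\<lambda>s. s \<noteq> Blank) r"

definition tm_computes_within :: "'a tm \<Rightarrow> nat \<Rightarrow> 'a symbol list \<Rightarrow> 'a symbol list \<Rightarrow> bool" where
  "tm_computes_within M n w v \<longleftrightarrow>
     (\<exists>q t ts. (tm_step M ^^ n) (tm_init M w) = (q, t # ts) \<and> q = halt M \<and> tape_output t = v)"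

text \<open>
  \<open>f\<close>, restricted to inputs in \<open>D\<close>, is computable in polynomial time when inputs and outputs are
  written on the tape as prescribed by \<open>enc_in\<close> and \<open>enc_out\<close>. Halting configurations are fixed
  points of \<open>tm_step\<close>, so having halted at step \<open>n\<close> means having halted after at most \<open>n\<close> steps.
\<close>

definition poly_time_computable ::
  "'i set \<Rightarrow> ('i \<Rightarrow> 'a symbol list) \<Rightarrow> ('o \<Rightarrow> 'a symbol list) \<Rightarrow> ('i \<Rightarrow> 'o) \<Rightarrow> bool" where
  "poly_time_computable D enc_in enc_out f \<longleftrightarrow>
     (\<exists>(M :: 'a tm) (p :: nat poly). wf_tm M \<and>
        (\<forall>x \<in> D. set (enc_in x) \<subseteq> symbols M - {Blank} \<and>
           tm_computes_within M (poly p (length (enc_in x))) (enc_in x) (enc_out (f x))))"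


section \<open>Polynomial-time truth-table reducibility\<close>

definition enc_word :: "'a list \<Rightarrow> 'a symbol list" where
  "enc_word x = map Letter x"

definition enc_queries :: "'a list list \<Rightarrow> 'a symbol list" where
  "enc_queries ys = concat (map (\<lambda>y. enc_word y @ [Sep]) ys)"

definition enc_answers :: "'a list \<times> bool list \<Rightarrow> 'a symbol list" where
  "enc_answers = (\<lambda>(x, bs). enc_word x @ [Sep] @ map Bit bs)"

definition enc_verdict :: "bool \<Rightarrow> 'a symbol list" where
  "enc_verdict b = [Bit b]"

text \<open>
  For languages \<open>A, B \<subseteq> \<Sigma>\<^sup>*\<close>: a generator \<open>f\<close> produces all queries from the input in advance
  (nonadaptively), and an evaluator \<open>e\<close> decides membership in \<open>A\<close> from the input and the answers;
  both run in polynomial time.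
\<close>

definition poly_tt_reducible :: "'a set \<Rightarrow> 'a list set \<Rightarrow> 'a list set \<Rightarrow> bool" where
  "poly_tt_reducible \<Sigma> A B \<longleftrightarrow>
     (\<exists>(f :: 'a list \<Rightarrow> 'a list list) (e :: 'a list \<times> bool list \<Rightarrow> bool).
        f ` lists \<Sigma> \<subseteq> lists (lists \<Sigma>) \<and>
        poly_time_computable (lists \<Sigma>) enc_word enc_queries f \<and>
        poly_time_computable (lists \<Sigma> \<times> UNIV) enc_answers enc_verdict e \<and>
        (\<forall>x \<in> lists \<Sigma>. x \<in> A \<longleftrightarrow> e (x, map (\<lambda>y. y \<in> B) (f x))))"


section \<open>Constraints and constraint applications\<close>

text \<open>
  A constraint of arity \<open>k\<close>. Elements of \<open>{0,1}\<^sup>k\<close> are lists of length \<open>k\<close>; the values of \<open>eval_con\<close>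
  on lists of other lengths play no role.
\<close>

datatype con = Con (arity: nat) (eval_con: "bool list \<Rightarrow> bool")

text \<open>Variables are named by binary strings.\<close>

type_synonym var = "bool list"

datatype arg = Var var | Const bool

type_synonym app = "con \<times> arg list"

definition apps :: "con set \<Rightarrow> app set" where
  "apps \<C> = {(c, xs). c \<in> \<C> \<and> length xs = arity c}"

fun eval_arg :: "(var \<Rightarrow> bool) \<Rightarrow> arg \<Rightarrow> bool" where
  "eval_arg \<alpha> (Var v) = \<alpha> v"
| "eval_arg \<alpha> (Const b) = b"

definition satisfies :: "(var \<Rightarrow> bool) \<Rightarrow> app set \<Rightarrow> bool" where
  "satisfies \<alpha> S \<longleftrightarrow> (\<forall>(c, xs) \<in> S. eval_con c (map (eval_arg \<alpha>) xs))"

definition satisfiable :: "app set \<Rightarrow> bool" where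
  "satisfiable S \<longleftrightarrow> (\<exists>\<alpha>. satisfies \<alpha> S)"

definition equivalent :: "app set \<Rightarrow> app set \<Rightarrow> bool" where
  "equivalent S U \<longleftrightarrow> (\<forall>\<alpha>. satisfies \<alpha> S \<longleftrightarrow> satisfies \<alpha> U)"


section \<open>The decision problems as languages\<close>

text \<open>
  Since the finite set of constraints is fixed, every constraint in it is a single letter of the
  input alphabet. A variable is written as \<open>LVar\<close> followed by the bits of its name.
\<close>

datatype letter = LCon con | LConst bool | LVar | LDigit bool | LBar

definition alphabet :: "con set \<Rightarrow> letter set" where
  "alphabet \<C> = LCon ` \<C> \<union> range LConst \<union> {LVar} \<union> range LDigit \<union> {LBar}"

fun enc_arg :: "arg \<Rightarrow> letter list" where
  "enc_arg (Var v) = LVar # map LDigit v"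
| "enc_arg (Const b) = [LConst b]"

definition enc_app :: "app \<Rightarrow> letter list" where
  "enc_app = (\<lambda>(c, xs). LCon c # concat (map enc_arg xs))"

text \<open>
  A finite set of constraint applications is written by listing its members, in any order and
  possibly with repetitions.
\<close>

definition enc_apps :: "app list \<Rightarrow> letter list" where
  "enc_apps ss = concat (map enc_app ss)"

definition CSP_c :: "con set \<Rightarrow> letter list set" where
  "CSP_c \<C> = {enc_apps ss | ss. set ss \<subseteq> apps \<C> \<and> satisfiable (set ss)}"

definition EQUIV_c :: "con set \<Rightarrow> letter list set" where
  "EQUIV_c \<C> = {enc_apps ss @ [LBar] @ enc_apps us | ss us.
     set ss \<subseteq> apps \<C> \<and> set us \<subseteq> apps \<C> \<and> equivalent (set ss) (set us)}"

end

theory Submission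
  imports Defs
begin

text \<open>
  \<open>S\<close> and \<open>U\<close> are inequivalent iff, for one of them, say \<open>U\<close>, some application \<open>C(x)\<close> in it is
  falsified by an assignment satisfying the other one, \<open>S\<close>. For every tuple \<open>a\<close> with \<open>C(a) = 0\<close> the
  reduction therefore asks whether \<open>S\<close> remains satisfiable after the substitution of \<open>a\<close> for \<open>x\<close>, and
  accepts iff all answers are negative. There are only finitely many pairs \<open>(C, a)\<close>, so the
  generator treats them one after the other. The evaluator is a finite automaton: whether a word
  encodes a pair of sets of constraint applications is a regular property, as is the absence of
  positive answers.

  Machines are written as structured programs over a fixed number of stacks. A program is turned
  into a Turing machine with one tape per stack whose states are the finitely many lists of commands
  that can remain to be executed.
\<close>

section \<open>Structured programs for Turing machines\<close>

text \<open>Constants as arguments are what keeps the queries inside the same problem: after the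
  substitution of \<open>a\<close>, the other set is again an instance over the same constraints.
  Names of variables are binary strings of unbounded length, so comparing them exceeds a finite
  control; this is why the generator needs several stacks. Acceptance means that no answer is
  positive, so the evaluator never has to know which answer belongs to which query. Syntax is
  checked by the evaluator alone, and the generator may treat ill-formed words blindly as long as
  its queries stay within the alphabet. Every program carries an explicit time bound. The bounds
  stay polynomial because no substitution lengthens a word, and because the number of pairs and the
  lengths of the tuples depend only on the fixed set of constraints.\<close>

text \<open>
  A stack lies on its tape to the right of the head, its top under the head, with only blanks to
  the left. \<open>Shift j\<close> pushes a blank on stack \<open>j\<close> by moving left, and \<open>Put j g\<close> overwrites the top, so a
  push takes both. Functions and tests see the tops of all stacks; the top of an empty one is \<open>Blank\<close>.
\<close>

datatype 'a cmd =
    Skip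
  | Shift nat
  | Pop nat
  | Put nat "(nat \<Rightarrow> 'a symbol) \<Rightarrow> 'a symbol"
  | Seq "'a cmd" "'a cmd"
  | Cond "(nat \<Rightarrow> 'a symbol) \<Rightarrow> bool" "'a cmd" "'a cmd"
  | Loop "(nat \<Rightarrow> 'a symbol) \<Rightarrow> bool" "'a cmd"

fun next_ctrl :: "'a cmd list \<Rightarrow> (nat \<Rightarrow> 'a symbol) \<Rightarrow> 'a cmd list" where
  "next_ctrl [] t = []"
| "next_ctrl (Skip # ks) t = ks"
| "next_ctrl (Shift j # ks) t = ks"
| "next_ctrl (Pop j # ks) t = ks"
| "next_ctrl (Put j g # ks) t = ks"
| "next_ctrl (Seq a b # ks) t = a # b # ks"
| "next_ctrl (Cond P a b # ks) t = (if P t then a else b) # ks"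
| "next_ctrl (Loop P a # ks) t = (if P t then a # Loop P a # ks else ks)"

text \<open>The control lists that can occur before \<open>ks\<close> is reached. A loop is put back
  below its body as the same list, so unboundedly many iterations pass through finitely many lists;
  this keeps the state set of the machine finite.\<close>

fun conts :: "'a cmd \<Rightarrow> 'a cmd list \<Rightarrow> 'a cmd list set" where
  "conts Skip ks = {Skip # ks}"
| "conts (Shift j) ks = {Shift j # ks}"
| "conts (Pop j) ks = {Pop j # ks}"
| "conts (Put j g) ks = {Put j g # ks}"
| "conts (Seq a b) ks = insert (Seq a b # ks) (conts a (b # ks) \<union> conts b ks)"
| "conts (Cond P a b) ks = insert (Cond P a b # ks) (conts a ks \<union> conts b ks)"
| "conts (Loop P a) ks = insert (Loop P a # ks) (conts a (Loop P a # ks))"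

lemma finite_conts: "finite (conts c ks)"
  by (induction c ks rule: conts.induct) auto

lemma conts_self: "c # ks \<in> conts c ks"
  by (cases c) auto

lemma next_ctrl_conts: "rs \<in> conts c ks \<Longrightarrow> next_ctrl rs t \<in> insert ks (conts c ks)"
proof (induction c ks rule: conts.induct)
  case (5 a b ks)
  then show ?case using conts_self[of a "b # ks"] conts_self[of b ks] by auto
next
  case (6 P a b ks)
  then show ?case using conts_self[of a ks] conts_self[of b ks] by auto
next
  case (7 P a ks)
  then show ?case using conts_self[of a "Loop P a # ks"] by (auto split: if_splits)
qed auto

section \<open>Tapes that represent stacks\<close>

definition reads :: "'a symbol list \<Rightarrow> nat \<Rightarrow> 'a symbol" where
  "reads ss i = (if i < length ss then ss ! i else Blank)"

definition top_sym :: "'a symbol list \<Rightarrow> 'a symbol" where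
  "top_sym xs = (if xs = [] then Blank else hd xs)"

lemma top_sym_simps [simp]: "top_sym [] = Blank" "top_sym (x # xs) = x"
  by (simp_all add: top_sym_def)

definition tops :: "(nat \<Rightarrow> 'a symbol list) \<Rightarrow> nat \<Rightarrow> 'a symbol" where
  "tops \<sigma> i = top_sym (\<sigma> i)"

text \<open>Explicit blanks on both sides are allowed, since moves leave them behind. One tape may
  therefore hold both \<open>[]\<close> and \<open>[Blank]\<close>, which makes writing a blank on
  an empty stack harmless.\<close>

definition tape_holds :: "'a tape \<Rightarrow> 'a symbol list \<Rightarrow> bool" where
  "tape_holds t xs \<longleftrightarrow> (\<exists>m n. t = Tape (replicate m Blank) (xs @ replicate n Blank))"

lemma tape_holds_read: "tape_holds t xs \<Longrightarrow> tape_read t = top_sym xs"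
proof -
  assume "tape_holds t xs"
  then obtain m n where "t = Tape (replicate m Blank) (xs @ replicate n Blank)"
    by (auto simp: tape_holds_def)
  then show ?thesis by (cases xs; cases n) auto
qed

lemma tape_holds_write: "tape_holds t xs \<Longrightarrow> tape_holds (tape_write s t) (s # tl xs)"
proof -
  assume "tape_holds t xs"
  then obtain m n where *: "t = Tape (replicate m Blank) (xs @ replicate n Blank)"
    by (auto simp: tape_holds_def)
  have "tl (xs @ replicate n Blank) = tl xs @ replicate (if xs = [] then n - 1 else n) Blank"
    by (cases xs; cases n) auto
  then show ?thesis unfolding tape_holds_def * tape_write.simps by force
qed

text \<open>A machine step writes on every tape, so each untouched stack has its own top written
  again; for an empty stack the new blank cell counts as padding.\<close>

lemma tape_holds_rewrite:
  assumes "tape_holds t xs" shows "tape_holds (tape_write (top_sym xs) t) xs"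
proof (cases xs)
  case Nil
  then have "tape_holds (tape_write Blank t) [Blank]"
    using tape_holds_write[OF assms, of Blank] by simp
  then obtain m n where "tape_write Blank t = Tape (replicate m Blank) (replicate (Suc n) Blank)"
    by (auto simp: tape_holds_def)
  then show ?thesis unfolding tape_holds_def using Nil by (metis append_Nil top_sym_simps(1))
next
  case (Cons y ys)
  then show ?thesis using tape_holds_write[OF assms, of y] by simp
qed

lemma tape_holds_left: "tape_holds t xs \<Longrightarrow> tape_holds (tape_move GoLeft t) (Blank # xs)"
proof -
  assume "tape_holds t xs"
  then obtain m n where *: "t = Tape (replicate m Blank) (xs @ replicate n Blank)"
    by (auto simp: tape_holds_def)
  have "tape_move GoLeft t = Tape (replicate (m - 1) Blank) ((Blank # xs) @ replicate n Blank)"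
    unfolding * by (cases m) auto
  then show ?thesis unfolding tape_holds_def by blast
qed

lemma tape_holds_right: "tape_holds t (Blank # xs) \<Longrightarrow> tape_holds (tape_move GoRight t) xs"
proof -
  assume "tape_holds t (Blank # xs)"
  then obtain m n where *: "t = Tape (replicate m Blank) ((Blank # xs) @ replicate n Blank)"
    by (auto simp: tape_holds_def)
  have "tape_move GoRight t = Tape (replicate (Suc m) Blank) (xs @ replicate n Blank)"
    unfolding * by simp
  then show ?thesis unfolding tape_holds_def by blast
qed

locale stack_machine =
  fixes K :: nat and \<Gamma> :: "'a symbol set"
  assumes K_pos: "K \<ge> 1" and finite_symbols: "finite \<Gamma>" and Blank_symbol: "Blank \<in> \<Gamma>"
begin

text \<open>The function inside \<open>Put\<close> is arbitrary, but a well-formed machine writes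
  only symbols from \<Gamma>. Clipping enforces this for all programs at once.\<close>

definition clip :: "'a symbol \<Rightarrow> 'a symbol" where
  "clip s = (if s \<in> \<Gamma> then s else Blank)"

lemma clip_in: "clip s \<in> \<Gamma>"
  using Blank_symbol by (simp add: clip_def)

lemma clip_id [simp]: "s \<in> \<Gamma> \<Longrightarrow> clip s = s"
  by (simp add: clip_def)

fun action :: "'a cmd \<Rightarrow> (nat \<Rightarrow> 'a symbol) \<Rightarrow> nat \<Rightarrow> 'a symbol \<times> direction" where
  "action (Shift j) t i = (t i, if i = j then GoLeft else Stay)"
| "action (Pop j) t i = (if i = j then (Blank, GoRight) else (t i, Stay))"
| "action (Put j g) t i = (if i = j then clip (g t) else t i, Stay)"
| "action _ t i = (t i, Stay)"

definition actions :: "'a cmd \<Rightarrow> (nat \<Rightarrow> 'a symbol) \<Rightarrow> ('a symbol \<times> direction) list" where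
  "actions c t = map (action c t) [0..<K]"

lemma action_symbol: "(\<And>i. t i \<in> \<Gamma>) \<Longrightarrow> fst (action c t i) \<in> \<Gamma>"
  by (cases c) (auto simp: clip_in Blank_symbol)

section \<open>Execution of programs with time bounds\<close>

definition cmd_step :: "'a cmd list \<times> 'a tape list \<Rightarrow> 'a cmd list \<times> 'a tape list" where
  "cmd_step = (\<lambda>(ks, ts). if ks = [] then (ks, ts) else
     let t = reads (map tape_read ts)
     in (next_ctrl ks t, map2 (\<lambda>(s, d) t. tape_move d (tape_write s t)) (actions (hd ks) t) ts))"

lemma cmd_step_halted [simp]: "(cmd_step ^^ m) ([], ts) = ([], ts)"
  by (induction m) (auto simp: cmd_step_def)

text \<open>Stacks from \<open>K\<close> on are empty so that the symbols read from the tapes,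
  padded with blanks, agree with \<open>tops \<sigma>\<close> at all indices.\<close>

definition holds :: "(nat \<Rightarrow> 'a symbol list) \<Rightarrow> 'a tape list \<Rightarrow> bool" where
  "holds \<sigma> ts \<longleftrightarrow> length ts = K \<and> (\<forall>i<K. tape_holds (ts ! i) (\<sigma> i)) \<and> (\<forall>i\<ge>K. \<sigma> i = [])"

lemma holds_reads: "holds \<sigma> ts \<Longrightarrow> reads (map tape_read ts) = tops \<sigma>"
  by (rule ext) (auto simp: holds_def reads_def tops_def tape_holds_read)

lemma cmd_step_holds:
  assumes "holds \<sigma> ts"
    and "\<And>i t. i < K \<Longrightarrow> tape_holds t (\<sigma> i) \<Longrightarrow>
      tape_holds (tape_move (snd (action c (tops \<sigma>) i)) (tape_write (fst (action c (tops \<sigma>) i)) t)) (\<sigma>' i)"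
    and "\<And>i. i \<ge> K \<Longrightarrow> \<sigma>' i = \<sigma> i"
  shows "\<exists>ts'. cmd_step (c # ks, ts) = (next_ctrl (c # ks) (tops \<sigma>), ts') \<and> holds \<sigma>' ts'"
  using assms holds_reads[OF assms(1)]
  by (auto simp: cmd_step_def actions_def holds_def Let_def split_beta)

definition idle :: "'a cmd \<Rightarrow> bool" where
  "idle c \<longleftrightarrow> (\<forall>t i. action c t i = (t i, Stay))"

lemma idle_simps [simp]:
  "idle Skip" "idle (Seq a b)" "idle (Cond P a b)" "idle (Loop P a)"
  by (auto simp: idle_def)

lemma cmd_step_idle:
  assumes "holds \<sigma> ts" and "idle c"
  shows "\<exists>ts'. cmd_step (c # ks, ts) = (next_ctrl (c # ks) (tops \<sigma>), ts') \<and> holds \<sigma> ts'"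
  using assms by (intro cmd_step_holds) (auto simp: idle_def tops_def intro: tape_holds_rewrite)

text \<open>A total-correctness triple with a time bound. Quantifying over the remaining control
  \<open>ks\<close> makes it compose, and \<open>m\<le>n\<close> allows rough bounds.\<close>

definition run :: "'a cmd \<Rightarrow> nat \<Rightarrow> (nat \<Rightarrow> 'a symbol list) \<Rightarrow> (nat \<Rightarrow> 'a symbol list) \<Rightarrow> bool" where
  "run c n \<sigma> \<sigma>' \<longleftrightarrow> (\<forall>ks ts. holds \<sigma> ts \<longrightarrow>
     (\<exists>m\<le>n. \<exists>ts'. (cmd_step ^^ m) (c # ks, ts) = (ks, ts') \<and> holds \<sigma>' ts'))"

lemma run_mono: "run c m \<sigma> \<sigma>' \<Longrightarrow> m \<le> n \<Longrightarrow> run c n \<sigma> \<sigma>'"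
  unfolding run_def by (meson order_trans)

lemma run_single:
  assumes "\<And>ks. next_ctrl (c # ks) (tops \<sigma>) = ks"
    and "\<And>i t. i < K \<Longrightarrow> tape_holds t (\<sigma> i) \<Longrightarrow>
      tape_holds (tape_move (snd (action c (tops \<sigma>) i)) (tape_write (fst (action c (tops \<sigma>) i)) t)) (\<sigma>' i)"
    and "\<And>i. i \<ge> K \<Longrightarrow> \<sigma>' i = \<sigma> i"
  shows "run c 1 \<sigma> \<sigma>'"
  unfolding run_def
proof (intro allI impI)
  fix ks ts assume "holds \<sigma> ts"
  from cmd_step_holds[OF this assms(2,3), of ks]
  show "\<exists>m\<le>1. \<exists>ts'. (cmd_step ^^ m) (c # ks, ts) = (ks, ts') \<and> holds \<sigma>' ts'"
    using assms(1) by (intro exI[of _ 1]) auto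
qed

lemma run_Skip: "run Skip 1 \<sigma> \<sigma>"
  by (rule run_single) (auto simp: tops_def intro: tape_holds_rewrite)

lemma run_Shift: "j < K \<Longrightarrow> run (Shift j) 1 \<sigma> (\<sigma>(j := Blank # \<sigma> j))"
  by (rule run_single) (auto simp: tops_def intro: tape_holds_rewrite tape_holds_left)

lemma run_Pop: "j < K \<Longrightarrow> run (Pop j) 1 \<sigma> (\<sigma>(j := tl (\<sigma> j)))"
  by (rule run_single)
    (auto simp: tops_def intro: tape_holds_rewrite intro!: tape_holds_right tape_holds_write)

lemma run_Put:
  "j < K \<Longrightarrow> g (tops \<sigma>) \<in> \<Gamma> \<Longrightarrow> run (Put j g) 1 \<sigma> (\<sigma>(j := g (tops \<sigma>) # tl (\<sigma> j)))"
  by (rule run_single) (auto simp: tops_def intro: tape_holds_rewrite tape_holds_write)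

lemma run_unfold:
  assumes "idle c" and "\<And>ks. next_ctrl (c # ks) (tops \<sigma>) = a # ks" and "run a n \<sigma> \<sigma>'"
  shows "run c (Suc n) \<sigma> \<sigma>'"
  unfolding run_def
proof (intro allI impI)
  fix ks ts assume "holds \<sigma> ts"
  from cmd_step_idle[OF this assms(1), of ks] obtain ts1 where
    1: "cmd_step (c # ks, ts) = (a # ks, ts1)" "holds \<sigma> ts1"
    using assms(2) by auto
  with assms(3) obtain m ts2 where
    2: "m \<le> n" "(cmd_step ^^ m) (a # ks, ts1) = (ks, ts2)" "holds \<sigma>' ts2"
    unfolding run_def by blast
  have "(cmd_step ^^ Suc m) (c # ks, ts) = (ks, ts2)"
    unfolding funpow_Suc_right using 1 2 by simp
  with 2 show "\<exists>m\<le>Suc n. \<exists>ts'. (cmd_step ^^ m) (c # ks, ts) = (ks, ts') \<and> holds \<sigma>' ts'"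
    by (intro exI[of _ "Suc m"]) auto
qed

text \<open>Sequencing and a loop whose test succeeds behave alike: both replace the first command
  by two.\<close>

lemma run_unfold2:
  assumes "idle c" and "\<And>ks. next_ctrl (c # ks) (tops \<sigma>) = a # b # ks"
    and "run a m \<sigma> \<sigma>'" and "run b n \<sigma>' \<sigma>''"
  shows "run c (Suc (m + n)) \<sigma> \<sigma>''"
  unfolding run_def
proof (intro allI impI)
  fix ks ts assume "holds \<sigma> ts"
  from cmd_step_idle[OF this assms(1), of ks] obtain ts1 where
    1: "cmd_step (c # ks, ts) = (a # b # ks, ts1)" "holds \<sigma> ts1"
    using assms(2) by auto
  with assms(3) obtain m' ts2 where
    2: "m' \<le> m" "(cmd_step ^^ m') (a # b # ks, ts1) = (b # ks, ts2)" "holds \<sigma>' ts2"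
    unfolding run_def by blast
  with assms(4) obtain n' ts3 where
    3: "n' \<le> n" "(cmd_step ^^ n') (b # ks, ts2) = (ks, ts3)" "holds \<sigma>'' ts3"
    unfolding run_def by blast
  have "(cmd_step ^^ (n' + (m' + 1))) (c # ks, ts) = (ks, ts3)"
    unfolding funpow_add using 1 2 3 by simp
  with 2 3 show "\<exists>k\<le>Suc (m + n). \<exists>ts'. (cmd_step ^^ k) (c # ks, ts) = (ks, ts') \<and> holds \<sigma>'' ts'"
    by (intro exI[of _ "n' + (m' + 1)"]) auto
qed

lemma run_Seq: "run a m \<sigma> \<sigma>' \<Longrightarrow> run b n \<sigma>' \<sigma>'' \<Longrightarrow> run (Seq a b) (Suc (m + n)) \<sigma> \<sigma>''"
  by (rule run_unfold2) auto

lemma run_Cond_True: "P (tops \<sigma>) \<Longrightarrow> run a n \<sigma> \<sigma>' \<Longrightarrow> run (Cond P a b) (Suc n) \<sigma> \<sigma>'"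
  by (rule run_unfold[where a = a]) auto

lemma run_Cond_False: "\<not> P (tops \<sigma>) \<Longrightarrow> run b n \<sigma> \<sigma>' \<Longrightarrow> run (Cond P a b) (Suc n) \<sigma> \<sigma>'"
  by (rule run_unfold[where a = b]) auto

lemma run_Loop_True:
  "P (tops \<sigma>) \<Longrightarrow> run a m \<sigma> \<sigma>' \<Longrightarrow> run (Loop P a) n \<sigma>' \<sigma>'' \<Longrightarrow>
    run (Loop P a) (Suc (m + n)) \<sigma> \<sigma>''"
  by (rule run_unfold2) auto

lemma run_Loop_False: "\<not> P (tops \<sigma>) \<Longrightarrow> run (Loop P a) 1 \<sigma> \<sigma>"
  by (rule run_single) (auto simp: tops_def intro: tape_holds_rewrite)

section \<open>Compilation of programs into Turing machines\<close>

definition cmd_tm :: "'a cmd \<Rightarrow> 'a tm" where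
  "cmd_tm c = (let R = insert [] (conts c []); code = (SOME h :: 'a cmd list \<Rightarrow> nat. inj_on h R) in
     \<lparr>num_tapes = K, states = code ` R, start = code [c], halt = code [], symbols = \<Gamma>,
      trans = (\<lambda>q ss. let ks = inv_into R code q in
        (code (next_ctrl ks (reads ss)), actions (hd ks) (reads ss)))\<rparr>)"

lemma cmd_tm_code:
  obtains code where "inj_on code (insert [] (conts c []))"
    and "cmd_tm c = \<lparr>num_tapes = K, states = code ` insert [] (conts c []), start = code [c],
      halt = code [], symbols = \<Gamma>,
      trans = (\<lambda>q ss. let ks = inv_into (insert [] (conts c [])) code q in
        (code (next_ctrl ks (reads ss)), actions (hd ks) (reads ss)))\<rparr>"
proof -
  let ?R = "insert [] (conts c [])"
  have "\<exists>h :: 'a cmd list \<Rightarrow> nat. inj_on h ?R"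
    using finite_imp_inj_to_nat_seg[of ?R] finite_conts[of c "[]"] by auto
  then have "inj_on (SOME h :: 'a cmd list \<Rightarrow> nat. inj_on h ?R) ?R"
    by (rule someI_ex)
  then show ?thesis by (rule that) (simp add: cmd_tm_def Let_def)
qed

lemma next_ctrl_reachable:
  "ks \<in> insert [] (conts c []) \<Longrightarrow> next_ctrl ks t \<in> insert [] (conts c [])"
  using next_ctrl_conts[of ks c "[]" t] by auto

lemma wf_cmd_tm: "wf_tm (cmd_tm c)"
proof -
  let ?R = "insert [] (conts c [])"
  obtain code where code: "inj_on code ?R" and M: "cmd_tm c = \<lparr>num_tapes = K, states = code ` ?R,
      start = code [c], halt = code [], symbols = \<Gamma>,
      trans = (\<lambda>q ss. let ks = inv_into ?R code q in
        (code (next_ctrl ks (reads ss)), actions (hd ks) (reads ss)))\<rparr>"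
    by (rule cmd_tm_code)
  show ?thesis
    unfolding wf_tm_def
  proof (intro conjI ballI impI)
    fix q ss
    assume q: "q \<in> states (cmd_tm c)" and ss: "ss \<in> lists (symbols (cmd_tm c))"
    obtain ks where ks: "ks \<in> ?R" "q = code ks"
      using q by (auto simp: M)
    have trans: "trans (cmd_tm c) q ss = (code (next_ctrl ks (reads ss)), actions (hd ks) (reads ss))"
      using inv_into_f_f[OF code ks(1)] ks(2) by (simp add: M)
    show "fst (trans (cmd_tm c) q ss) \<in> states (cmd_tm c)"
      unfolding trans using imageI[OF next_ctrl_reachable[OF ks(1), of "reads ss"], of code]
      by (simp add: M)
    show "length (snd (trans (cmd_tm c) q ss)) = num_tapes (cmd_tm c)"
      unfolding trans by (simp add: M actions_def)
    have "reads ss i \<in> \<Gamma>" for i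
      using ss Blank_symbol by (auto simp: M reads_def lists_eq_set)
    then show "fst ` set (snd (trans (cmd_tm c) q ss)) \<subseteq> symbols (cmd_tm c)"
      unfolding trans by (auto simp: M actions_def action_symbol)
  qed (use K_pos finite_symbols Blank_symbol finite_conts[of c "[]"] conts_self[of c "[]"]
    in \<open>simp_all add: M\<close>)
qed

text \<open>The machine simulates \<open>cmd_step\<close> through the numbering of control lists.
  The result must be free of blanks because the output word ends at the first blank.\<close>

lemma cmd_tm_computes:
  assumes "run c n ((\<lambda>_. [])(0 := w)) \<sigma>" and "Blank \<notin> set (\<sigma> 0)" and "n \<le> N"
  shows "tm_computes_within (cmd_tm c) N w (\<sigma> 0)"
proof -
  let ?R = "insert [] (conts c [])"
  obtain code where code: "inj_on code ?R" and M: "cmd_tm c = \<lparr>num_tapes = K, states = code ` ?R,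
      start = code [c], halt = code [], symbols = \<Gamma>,
      trans = (\<lambda>q ss. let ks = inv_into ?R code q in
        (code (next_ctrl ks (reads ss)), actions (hd ks) (reads ss)))\<rparr>"
    by (rule cmd_tm_code)
  have step: "tm_step (cmd_tm c) (code ks, ts) = map_prod code id (cmd_step (ks, ts))"
    if "ks \<in> ?R" for ks ts
  proof (cases "ks = []")
    case True
    then show ?thesis by (simp add: tm_step_def cmd_step_def M)
  next
    case False
    \<comment> \<open>Injectivity keeps an unfinished control list away from the halting
      state.\<close>
    then have "code ks \<noteq> code []"
      using code that by (metis inj_onD insertI1)
    then show ?thesis
      using False inv_into_f_f[OF code that] by (simp add: tm_step_def cmd_step_def M Let_def)
  qed
  have steps: "(tm_step (cmd_tm c) ^^ m) (code ks, ts) = map_prod code id ((cmd_step ^^ m) (ks, ts))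
      \<and> fst ((cmd_step ^^ m) (ks, ts)) \<in> ?R" if "ks \<in> ?R" for m ks ts
  proof (induction m)
    case 0
    then show ?case using that by simp
  next
    case (Suc m)
    obtain ks' ts' where eq: "(cmd_step ^^ m) (ks, ts) = (ks', ts')" by fastforce
    with Suc have "ks' \<in> ?R" by simp
    moreover have "fst (cmd_step (ks', ts')) \<in> ?R"
      using next_ctrl_reachable[OF \<open>ks' \<in> ?R\<close>] \<open>ks' \<in> ?R\<close> by (simp add: cmd_step_def Let_def)
    ultimately show ?case using Suc eq step[OF \<open>ks' \<in> ?R\<close>] by (simp add: id_def)
  qed
  define ts where "ts = Tape [] w # replicate (K - 1) (Tape [] [])"
  have th: "tape_holds (Tape [] v) v" for v :: "'a symbol list"
    unfolding tape_holds_def by (rule exI[of _ 0])+ simp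
  have "holds ((\<lambda>_. [])(0 := w)) ts"
    using K_pos by (auto simp: holds_def ts_def nth_Cons th split: nat.splits)
  then obtain m ts' where m: "m \<le> n" "(cmd_step ^^ m) ([c], ts) = ([], ts')" "holds \<sigma> ts'"
    using assms(1) unfolding run_def by blast
  \<comment> \<open>Steps after termination change nothing, so a run of \<open>m\<close> steps
    serves for the full bound \<open>N\<close>.\<close>
  have "(cmd_step ^^ N) ([c], ts) = ([], ts')"
    using m(1,2) assms(3) funpow_add[of "N - m" m cmd_step] by simp
  then have fin: "(tm_step (cmd_tm c) ^^ N) (tm_init (cmd_tm c) w) = (code [], ts')"
    using steps[of "[c]" N ts] conts_self[of c "[]"] by (simp add: tm_init_def M ts_def)
  obtain t rest where t: "ts' = t # rest"
    using m(3) K_pos by (cases ts') (auto simp: holds_def)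
  then have "tape_holds t (\<sigma> 0)"
    using m(3) K_pos by (force simp: holds_def)
  then have "tape_output t = \<sigma> 0"
    using assms(2) by (force simp: tape_holds_def takeWhile_append takeWhile_eq_all_conv)
  then show ?thesis
    unfolding tm_computes_within_def using fin t by (simp add: M)
qed

lemma run_poly_time_computable:
  assumes "\<And>x. x \<in> D \<Longrightarrow> set (enc_in x) \<subseteq> \<Gamma> - {Blank}"
    and "\<And>x. x \<in> D \<Longrightarrow> \<exists>\<sigma>. run c (A * (length (enc_in x) + 1) ^ k) ((\<lambda>_. [])(0 := enc_in x)) \<sigma> \<and>
      \<sigma> 0 = enc_out (f x) \<and> Blank \<notin> set (enc_out (f x))"
  shows "poly_time_computable D enc_in enc_out f"
  unfolding poly_time_computable_def
proof (intro exI conjI ballI)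
  let ?p = "smult A ([:1, 1:] ^ k) :: nat poly"
  show "wf_tm (cmd_tm c)" by (rule wf_cmd_tm)
  fix x assume x: "x \<in> D"
  show "set (enc_in x) \<subseteq> symbols (cmd_tm c) - {Blank}"
    using assms(1)[OF x] by (simp add: cmd_tm_def Let_def)
  have "poly ?p (length (enc_in x)) = A * (length (enc_in x) + 1) ^ k"
    by (simp add: poly_power add.commute)
  with assms(2)[OF x] cmd_tm_computes
  show "tm_computes_within (cmd_tm c) (poly ?p (length (enc_in x))) (enc_in x) (enc_out (f x))"
    by (metis order_refl)
qed

end

section \<open>Stack programs\<close>

context stack_machine
begin

lemma run_seq:
  "run a m \<sigma> \<sigma>' \<Longrightarrow> run b n \<sigma>' \<sigma>'' \<Longrightarrow> m + n < N \<Longrightarrow> run (Seq a b) N \<sigma> \<sigma>''"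
  by (rule run_mono[OF run_Seq]) auto

lemma run_loop_step:
  "P (tops \<sigma>) \<Longrightarrow> run a m \<sigma> \<sigma>' \<Longrightarrow> run (Loop P a) n \<sigma>' \<sigma>'' \<Longrightarrow> m + n < N \<Longrightarrow>
    run (Loop P a) N \<sigma> \<sigma>''"
  by (rule run_mono[OF run_Loop_True]) auto

lemma run_cond:
  assumes "P (tops \<sigma>) \<Longrightarrow> run a m \<sigma> \<sigma>'" and "\<not> P (tops \<sigma>) \<Longrightarrow> run b m \<sigma> \<sigma>'" and "m < N"
  shows "run (Cond P a b) N \<sigma> \<sigma>'"
  using assms run_Cond_True[of P \<sigma> a m \<sigma>' b] run_Cond_False[of P \<sigma> b m \<sigma>' a]
  by (cases "P (tops \<sigma>)") (auto elim!: run_mono)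

lemma run_eq: "run c m \<sigma> \<sigma>' \<Longrightarrow> \<sigma>' = \<sigma>'' \<Longrightarrow> m \<le> n \<Longrightarrow> run c n \<sigma> \<sigma>''"
  by (auto intro: run_mono)

text \<open>The function \<open>g\<close> sees a blank on top of stack \<open>j\<close> itself.\<close>

definition push :: "nat \<Rightarrow> ((nat \<Rightarrow> 'a symbol) \<Rightarrow> 'a symbol) \<Rightarrow> 'a cmd" where
  "push j g = Seq (Shift j) (Put j g)"

definition move :: "nat \<Rightarrow> nat \<Rightarrow> 'a cmd" where
  "move i j = Seq (push j (\<lambda>t. t i)) (Pop i)"

definition move_while :: "'a symbol set \<Rightarrow> nat \<Rightarrow> nat \<Rightarrow> 'a cmd" where
  "move_while A i j = Loop (\<lambda>t. t i \<in> A) (move i j)"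

definition drop_while :: "'a symbol set \<Rightarrow> nat \<Rightarrow> 'a cmd" where
  "drop_while A i = Loop (\<lambda>t. t i \<in> A) (Pop i)"

text \<open>Reading a stack consumes it, so the source passes through stack \<open>k\<close>. The
  second pass restores it together with the copy, both in the original order because they have been
  reversed twice.\<close>

definition copy :: "nat \<Rightarrow> nat \<Rightarrow> nat \<Rightarrow> 'a cmd" where
  "copy i j k = Seq (move_while (- {Blank}) i k)
     (Loop (\<lambda>t. t k \<noteq> Blank) (Seq (push i (\<lambda>t. t k)) (Seq (push j (\<lambda>t. t k)) (Pop k))))"

lemma tops_upd: "tops (\<sigma>(j := xs)) = (tops \<sigma>)(j := top_sym xs)"
  by (auto simp: tops_def)

lemma run_push:
  assumes "j < K" and "g ((tops \<sigma>)(j := Blank)) = s" and "s \<in> \<Gamma>"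
  shows "run (push j g) 3 \<sigma> (\<sigma>(j := s # \<sigma> j))"
  unfolding push_def using assms
  by (intro run_seq[OF run_Shift run_eq[OF run_Put]]) (auto simp: tops_upd)

lemma run_move:
  assumes "i < K" "j < K" "i \<noteq> j" and "\<sigma> i = x # xs" and "x \<in> \<Gamma>"
  shows "run (move i j) 5 \<sigma> (\<sigma>(i := xs, j := x # \<sigma> j))"
  unfolding move_def using assms
  by (intro run_seq[OF run_push[where s = x] run_eq[OF run_Pop]])
    (auto simp: tops_def fun_upd_twist)

text \<open>Five steps for the move and one for the test give the factor 6. For empty
  \<open>ys\<close> the last condition says that \<open>A\<close> does not contain
  \<open>Blank\<close>.\<close>

lemma run_move_while:
  assumes "i < K" "j < K" "i \<noteq> j" and "\<sigma> i = xs @ ys" and "set xs \<subseteq> A \<inter> \<Gamma>"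
    and "top_sym ys \<notin> A"
  shows "run (move_while A i j) (6 * length xs + 1) \<sigma> (\<sigma>(i := ys, j := rev xs @ \<sigma> j))"
  using assms(4,5)
proof (induction xs arbitrary: \<sigma>)
  case Nil
  then show ?case
    unfolding move_while_def using assms(6) by (intro run_eq[OF run_Loop_False]) (auto simp: tops_def)
next
  case (Cons x xs)
  have 1: "run (move i j) 5 \<sigma> (\<sigma>(i := xs @ ys, j := x # \<sigma> j))"
    using Cons.prems assms(1-3) by (intro run_move) auto
  have 2: "run (move_while A i j) (6 * length xs + 1) (\<sigma>(i := xs @ ys, j := x # \<sigma> j))
      (\<sigma>(i := ys, j := rev (x # xs) @ \<sigma> j))"
    using Cons.prems assms(3)
    by (intro run_eq[OF Cons.IH]) (auto simp: fun_upd_twist)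
  show ?case
    unfolding move_while_def
    by (rule run_loop_step[OF _ 1 2[unfolded move_while_def]]) (use Cons.prems in \<open>auto simp: tops_def\<close>)
qed

lemma run_move_all:
  assumes "i < K" "j < K" "i \<noteq> j" and "set (\<sigma> i) \<subseteq> \<Gamma> - {Blank}"
  shows "run (move_while (- {Blank}) i j) (6 * length (\<sigma> i) + 1) \<sigma> (\<sigma>(i := [], j := rev (\<sigma> i) @ \<sigma> j))"
  using assms run_move_while[of i j \<sigma> "\<sigma> i" "[]" "- {Blank}"] by auto

lemma run_drop_while:
  assumes "i < K" and "\<sigma> i = xs @ ys" and "set xs \<subseteq> A" and "top_sym ys \<notin> A"
  shows "run (drop_while A i) (2 * length xs + 1) \<sigma> (\<sigma>(i := ys))"
  using assms(2,3)
proof (induction xs arbitrary: \<sigma>)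
  case Nil
  then show ?case
    unfolding drop_while_def using assms(4) by (intro run_eq[OF run_Loop_False]) (auto simp: tops_def)
next
  case (Cons x xs)
  have 1: "run (Pop i) 1 \<sigma> (\<sigma>(i := xs @ ys))"
    using Cons.prems assms(1) by (intro run_eq[OF run_Pop]) auto
  have 2: "run (drop_while A i) (2 * length xs + 1) (\<sigma>(i := xs @ ys)) (\<sigma>(i := ys))"
    using Cons.prems by (intro run_eq[OF Cons.IH]) auto
  show ?case
    unfolding drop_while_def
    by (rule run_loop_step[OF _ 1 2[unfolded drop_while_def]]) (use Cons.prems in \<open>auto simp: tops_def\<close>)
qed

lemma run_copy:
  assumes "i < K" "j < K" "k < K" "i \<noteq> j" "i \<noteq> k" "j \<noteq> k"
    and "\<sigma> k = []" and "set (\<sigma> i) \<subseteq> \<Gamma> - {Blank}"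
  shows "run (copy i j k) (20 * length (\<sigma> i) + 5) \<sigma> (\<sigma>(j := \<sigma> i @ \<sigma> j))"
proof -
  let ?L = "Loop (\<lambda>t. t k \<noteq> Blank) (Seq (push i (\<lambda>t. t k)) (Seq (push j (\<lambda>t. t k)) (Pop k)))"
  have loop: "run ?L (12 * length xs + 1) \<tau> (\<tau>(k := [], i := rev xs @ \<tau> i, j := rev xs @ \<tau> j))"
    if "\<tau> k = xs" "set xs \<subseteq> \<Gamma> - {Blank}" for xs \<tau>
    using that
  proof (induction xs arbitrary: \<tau>)
    case Nil
    then show ?case by (intro run_eq[OF run_Loop_False]) (auto simp: tops_def)
  next
    case (Cons x xs)
    have "run (Seq (push i (\<lambda>t. t k)) (Seq (push j (\<lambda>t. t k)) (Pop k))) 9 \<tau>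
        (\<tau>(k := xs, i := x # \<tau> i, j := x # \<tau> j))"
      using Cons.prems assms(1-6)
      by (intro run_seq[OF run_push[where s = x] run_seq[OF run_push[where s = x] run_eq[OF run_Pop]]])
        (auto simp: tops_def fun_upd_twist)
    moreover have "run ?L (12 * length xs + 1) (\<tau>(k := xs, i := x # \<tau> i, j := x # \<tau> j))
        (\<tau>(k := [], i := rev (x # xs) @ \<tau> i, j := rev (x # xs) @ \<tau> j))"
      using Cons.prems assms(4-6)
      by (intro run_eq[OF Cons.IH]) (auto simp: fun_eq_iff)
    ultimately show ?case
      by (rule run_loop_step[rotated]) (use Cons.prems in \<open>auto simp: tops_def\<close>)
  qed
  have "run ?L (12 * length (\<sigma> i) + 1) (\<sigma>(i := [], k := rev (\<sigma> i))) (\<sigma>(j := \<sigma> i @ \<sigma> j))"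
    using assms by (intro run_eq[OF loop[where xs = "rev (\<sigma> i)"]]) (auto simp: fun_eq_iff)
  moreover have "run (move_while (- {Blank}) i k) (6 * length (\<sigma> i) + 1) \<sigma>
      (\<sigma>(i := [], k := rev (\<sigma> i)))"
    using assms by (intro run_eq[OF run_move_all]) auto
  ultimately show ?thesis unfolding copy_def by (intro run_seq) auto
qed

text \<open>The control of a program is fixed by its text, so the state of the automaton is kept as
  a symbol on stack 1. \<open>Put\<close> on an empty stack creates its only cell, for the initial
  state as well as for the final verdict.\<close>

definition dfa_cmd ::
  "('s \<Rightarrow> 'a symbol) \<Rightarrow> 's set \<Rightarrow> ('s \<Rightarrow> 'a symbol \<Rightarrow> 's) \<Rightarrow> 's \<Rightarrow> ('s \<Rightarrow> bool) \<Rightarrow> 'a cmd" where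
  "dfa_cmd code Q \<delta> q0 acc = Seq (Put 1 (\<lambda>_. code q0))
     (Seq (Loop (\<lambda>t. t 0 \<noteq> Blank)
       (Seq (Put 1 (\<lambda>t. code (\<delta> (inv_into Q code (t 1)) (t 0)))) (Pop 0)))
     (Put 0 (\<lambda>t. Bit (acc (inv_into Q code (t 1))))))"

lemma run_dfa_cmd:
  fixes q0 :: 's
  assumes "K \<ge> 2" and "inj_on code Q" and "code ` Q \<subseteq> \<Gamma>" and "range Bit \<subseteq> \<Gamma>"
    and "q0 \<in> Q" and \<delta>: "\<And>q s. q \<in> Q \<Longrightarrow> s \<in> \<Delta> \<Longrightarrow> \<delta> q s \<in> Q"
    and "set w \<subseteq> \<Delta>" and "Blank \<notin> \<Delta>"
  shows "\<exists>\<sigma>. run (dfa_cmd code Q \<delta> q0 acc) (8 * (length w + 1)) ((\<lambda>_. [])(0 := w)) \<sigma> \<and>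
    \<sigma> 0 = [Bit (acc (foldl \<delta> q0 w))]"
proof -
  have code_inv: "inv_into Q code (code q) = q" if "q \<in> Q" for q
    using assms(2) that by (rule inv_into_f_f)
  define st :: "'s \<Rightarrow> 'a symbol list \<Rightarrow> nat \<Rightarrow> 'a symbol list"
    where "st q w = (\<lambda>_. [])(0 := w, 1 := [code q])" for q w
  let ?B = "Seq (Put 1 (\<lambda>t. code (\<delta> (inv_into Q code (t 1)) (t 0)))) (Pop 0)"
  let ?L = "Loop (\<lambda>t. t 0 \<noteq> Blank) ?B"
  have body: "run ?B 3 (st q (s # w)) (st (\<delta> q s) w)" if "q \<in> Q" "s \<in> \<Delta>" for q s w
  proof -
    have "code (\<delta> q s) \<in> \<Gamma>" using \<delta>[OF that] assms(3) by blast
    then show ?thesis using assms(1) that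
      by (intro run_seq[OF run_Put run_eq[OF run_Pop]])
        (auto simp: st_def tops_def code_inv fun_eq_iff)
  qed
  have loop: "run ?L (4 * length w + 1) (st q w) (st (foldl \<delta> q w) [])"
    if "q \<in> Q" "set w \<subseteq> \<Delta>" for q w
    using that
  proof (induction w arbitrary: q)
    case Nil
    then show ?case by (intro run_eq[OF run_Loop_False]) (auto simp: st_def tops_def)
  next
    case (Cons s w)
    then show ?case
      using \<delta>[of q s] assms(8)
      by (intro run_loop_step[OF _ body run_eq[OF Cons.IH]]) (auto simp: st_def tops_def)
  qed
  have mem: "foldl \<delta> q w \<in> Q" if "q \<in> Q" "set w \<subseteq> \<Delta>" for q w
    using that \<delta> by (induction w arbitrary: q) auto
  let ?q = "foldl \<delta> q0 w"
  have "run (Put 1 (\<lambda>_. code q0)) 1 ((\<lambda>_. [])(0 := w)) (st q0 w)"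
    using assms(1,3,5) by (intro run_eq[OF run_Put]) (auto simp: st_def)
  moreover have "run (Put 0 (\<lambda>t. Bit (acc (inv_into Q code (t 1))))) 1 (st ?q [])
      ((st ?q [])(0 := [Bit (acc ?q)]))"
    using assms(1,4) mem[OF assms(5,7)]
    by (intro run_eq[OF run_Put]) (auto simp: st_def tops_def code_inv)
  ultimately have "run (dfa_cmd code Q \<delta> q0 acc) (8 * (length w + 1)) ((\<lambda>_. [])(0 := w))
      ((st ?q [])(0 := [Bit (acc ?q)]))"
    unfolding dfa_cmd_def using loop[OF assms(5,7)]
    by (elim run_seq[rotated -1] run_seq) auto
  then show ?thesis by (intro exI[of _ "(st ?q [])(0 := [Bit (acc ?q)])"]) simp
qed

end

lemma dfa_poly_time_computable:
  fixes enc :: "'i \<Rightarrow> 'a symbol list" and Q :: "'s set"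
  assumes "finite Q" and "q0 \<in> Q" and "\<And>q s. q \<in> Q \<Longrightarrow> s \<in> \<Delta> \<Longrightarrow> \<delta> q s \<in> Q"
    and "finite \<Delta>" and "Blank \<notin> \<Delta>" and "\<And>x. x \<in> D \<Longrightarrow> set (enc x) \<subseteq> \<Delta>"
  shows "poly_time_computable D enc enc_verdict (\<lambda>x. acc (foldl \<delta> q0 (enc x)))"
proof -
  obtain h :: "'s \<Rightarrow> nat" where h: "inj_on h Q"
    using finite_imp_inj_to_nat_seg[OF assms(1)] by auto
  define code where "code = (\<lambda>q. Work (h q) :: 'a symbol)"
  define \<Gamma> where "\<Gamma> = insert Blank (\<Delta> \<union> range Bit \<union> code ` Q)"
  interpret stack_machine 2 \<Gamma>
    by standard (auto simp: \<Gamma>_def assms(1,4))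
  have "inj_on code Q" using h by (auto simp: code_def inj_on_def)
  then have run: "\<exists>\<sigma>. run (dfa_cmd code Q \<delta> q0 acc) (8 * (length (enc x) + 1) ^ 1) ((\<lambda>_. [])(0 := enc x)) \<sigma> \<and>
      \<sigma> 0 = enc_verdict (acc (foldl \<delta> q0 (enc x))) \<and>
      Blank \<notin> set (enc_verdict (acc (foldl \<delta> q0 (enc x))))" if "x \<in> D" for x
    using run_dfa_cmd[of code Q q0 \<Delta> \<delta> "enc x" acc] assms that
    by (auto simp: enc_verdict_def \<Gamma>_def)
  show ?thesis
    by (rule run_poly_time_computable[where k = 1]) (use assms(5,6) in \<open>fastforce simp: \<Gamma>_def\<close>, rule run)
qed

section \<open>The queries\<close>

fun is_digit :: "letter \<Rightarrow> bool" where
  "is_digit (LDigit b) = True"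
| "is_digit _ = False"

text \<open>The end of a name is not marked, so the whole maximal block of digits is compared with
  \<open>v\<close>; a name that merely begins with \<open>v\<close> is left alone.\<close>

function substitute :: "letter list \<Rightarrow> bool \<Rightarrow> letter list \<Rightarrow> letter list" where
  "substitute v b [] = []"
| "substitute v b (x # r) =
     (if x = LVar
      then (if takeWhile is_digit r = v then [LConst b] else LVar # takeWhile is_digit r)
        @ substitute v b (dropWhile is_digit r)
      else x # substitute v b r)"
  by pat_completeness auto
termination
  by (relation "measure (\<lambda>(v, b, r). length r)") (auto simp: le_imp_less_Suc length_dropWhile_le)

text \<open>
  The generator works on a word consisting of the arguments that have not been assigned yet, the
  rest of the list containing the application, the letter \<open>LBar\<close>, and the other list. Substituting in
  all of it makes a variable repeated among the arguments reappear as a constant, so that a conflict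
  with its second value is noticed. The word is then erased, and no query is asked.
\<close>

fun assign_next :: "bool \<Rightarrow> letter list \<Rightarrow> letter list" where
  "assign_next b (LVar # r) = substitute (takeWhile is_digit r) b (dropWhile is_digit r)"
| "assign_next b (LConst b' # r) = (if b' = b then r else [])"
| "assign_next b _ = []"

definition after_bar :: "letter list \<Rightarrow> letter list" where
  "after_bar w = tl (dropWhile (\<lambda>x. x \<noteq> LBar) w)"

text \<open>The bar is tested because the empty word encodes the empty set, a satisfiable instance:
  an erased word must give no query rather than an empty one.\<close>

definition final_query :: "letter list \<Rightarrow> letter list list" where
  "final_query w = (if LBar \<in> set w then [after_bar w] else [])"

fun app_queries :: "con \<Rightarrow> bool list \<Rightarrow> letter list \<Rightarrow> letter list \<Rightarrow> letter list list" where
  "app_queries c a s [] = []"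
| "app_queries c a s (x # r) =
     (if x = LCon c then final_query (fold assign_next a (r @ LBar # s)) else [])
     @ app_queries c a s r"

definition pair_queries :: "con \<times> bool list \<Rightarrow> letter list \<Rightarrow> letter list list" where
  "pair_queries = (\<lambda>(c, a) w.
     let s = takeWhile (\<lambda>x. x \<noteq> LBar) w; u = after_bar w
     in app_queries c a s u @ app_queries c a u s)"

definition tt_queries :: "(con \<times> bool list) list \<Rightarrow> letter list \<Rightarrow> letter list list" where
  "tt_queries cas w = concat (map (\<lambda>ca. pair_queries ca w) cas)"

section \<open>Queries consist of letters of the input\<close>

lemma set_substitute: "set (substitute v b w) \<subseteq> insert (LConst b) (set w)"
  by (induction v b w rule: substitute.induct) (auto dest: set_takeWhileD set_dropWhileD)

text \<open>A replaced variable, marker and name, shrinks to a single letter. The time bounds rest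
  on this: it keeps the words worked on within the length of the input.\<close>

lemma length_substitute: "length (substitute v b w) \<le> length w"
proof (induction v b w rule: substitute.induct)
  case (2 v b x r)
  have "length (takeWhile is_digit r) + length (dropWhile is_digit r) = length r"
    by (metis length_append takeWhile_dropWhile_id)
  with 2 show ?case by auto
qed simp

lemma set_assign_next: "set (assign_next b w) \<subseteq> insert (LConst b) (set w)"
  using set_substitute
  by (cases "(b, w)" rule: assign_next.cases) (auto dest: set_takeWhileD set_dropWhileD, force dest: set_dropWhileD)

lemma length_assign_next: "length (assign_next b w) \<le> length w"
proof (cases "(b, w)" rule: assign_next.cases)
  case (1 b r)
  then show ?thesis
    using length_substitute[of "takeWhile is_digit r" b "dropWhile is_digit r"]
      length_dropWhile_le[of is_digit r] by auto
qed auto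

lemma set_fold_assign_next: "set (fold assign_next a w) \<subseteq> range LConst \<union> set w"
proof (induction a arbitrary: w)
  case (Cons b a)
  show ?case using Cons[of "assign_next b w"] set_assign_next[of b w] by auto
qed simp

lemma set_after_bar: "set (after_bar w) \<subseteq> set w"
  unfolding after_bar_def by (metis list.set_sel(2) set_dropWhileD subsetI tl_Nil)

text \<open>The generator must stay within the alphabet on every word, so no correct encoding is
  assumed. The only letters it can introduce are constants and the bar.\<close>

lemma tt_queries_lists:
  assumes "set w \<subseteq> \<Sigma>" and "range LConst \<subseteq> \<Sigma>" and "LBar \<in> \<Sigma>"
  shows "set (tt_queries cas w) \<subseteq> lists \<Sigma>"
proof -
  have "set (app_queries c a s u) \<subseteq> lists \<Sigma>" if "set s \<subseteq> \<Sigma>" "set u \<subseteq> \<Sigma>" for c a s u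
    using that(2)
  proof (induction u)
    case (Cons x u)
    have "set (fold assign_next a (u @ LBar # s)) \<subseteq> \<Sigma>"
      using that(1) Cons.prems assms(2,3) by (intro order_trans[OF set_fold_assign_next]) auto
    then have "set (final_query (fold assign_next a (u @ LBar # s))) \<subseteq> lists \<Sigma>"
      using set_after_bar by (fastforce simp: final_query_def)
    with Cons show ?case by auto
  qed simp
  moreover have "set (takeWhile (\<lambda>x. x \<noteq> LBar) w) \<subseteq> \<Sigma>" "set (after_bar w) \<subseteq> \<Sigma>"
    using assms(1) set_after_bar[of w] by (auto dest: set_takeWhileD)
  ultimately show ?thesis
    by (fastforce simp: tt_queries_def pair_queries_def Let_def)
qed

section \<open>Encodings\<close>

abbreviation enc_args :: "arg list \<Rightarrow> letter list" where
  "enc_args xs \<equiv> concat (map enc_arg xs)"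

abbreviation no_digit :: "letter list \<Rightarrow> bool" where
  "no_digit z \<equiv> takeWhile is_digit z = []"

lemma enc_apps_simps [simp]:
  "enc_apps [] = []"
  "enc_apps ((c, xs) # ss) = LCon c # enc_args xs @ enc_apps ss"
  by (simp_all add: enc_apps_def enc_app_def)

lemma no_digit_enc_args: "no_digit z \<Longrightarrow> no_digit (enc_args xs @ z)"
  by (cases xs rule: list.exhaust; cases "hd xs") auto

lemma no_digit_enc_apps: "no_digit z \<Longrightarrow> no_digit (enc_apps ss @ z)"
  by (cases ss) auto

lemma digits_append:
  assumes "no_digit z"
  shows "takeWhile is_digit (map LDigit v @ z) = map LDigit v"
    and "dropWhile is_digit (map LDigit v @ z) = z"
proof -
  have "dropWhile is_digit z = z"
    using assms by (cases z) (auto split: if_splits)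
  then show "takeWhile is_digit (map LDigit v @ z) = map LDigit v"
    "dropWhile is_digit (map LDigit v @ z) = z"
    using assms by (auto simp: takeWhile_append dropWhile_append)
qed

text \<open>The leading letter decides the kind of the first argument, and its name is the maximal
  block of digits, because neither a further argument nor \<open>z\<close> begins with a
  digit.\<close>

lemma enc_args_inj:
  "enc_args xs @ z = enc_args ys @ z' \<Longrightarrow> length xs = length ys \<Longrightarrow> no_digit z \<Longrightarrow> no_digit z' \<Longrightarrow>
    xs = ys \<and> z = z'"
proof (induction xs arbitrary: ys)
  case (Cons x xs)
  then obtain y ys' where ys: "ys = y # ys'" "length xs = length ys'" by (cases ys) auto
  note nd = no_digit_enc_args[OF Cons.prems(3), of xs] no_digit_enc_args[OF Cons.prems(4), of ys']
  have eq: "enc_arg x @ (enc_args xs @ z) = enc_arg y @ (enc_args ys' @ z')"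
    using Cons.prems(1) ys by simp
  have "x = y \<and> enc_args xs @ z = enc_args ys' @ z'"
  proof (cases x)
    case (Var v)
    then obtain v' where y: "y = Var v'" using eq by (cases y) auto
    from eq Var y have *: "map LDigit v @ enc_args xs @ z = map LDigit v' @ enc_args ys' @ z'"
      by simp
    have "map LDigit v = map LDigit v'"
      using arg_cong[OF *, of "takeWhile is_digit"] by (simp only: digits_append nd)
    moreover have "enc_args xs @ z = enc_args ys' @ z'"
      using arg_cong[OF *, of "dropWhile is_digit"] by (simp only: digits_append nd)
    ultimately show ?thesis using Var y by (auto dest: map_injective simp: inj_def)
  next
    case (Const b)
    then show ?thesis using eq by (cases y) auto
  qed
  then show ?case using Cons.IH[of ys'] Cons.prems(3,4) ys by auto
qed simp

text \<open>The constraint letter fixes the arity, hence the number of arguments to decode. The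
  conditions on \<open>z\<close> and \<open>z'\<close> cover both the end of the word and the
  bar.\<close>

lemma enc_apps_inj:
  "enc_apps ss @ z = enc_apps us @ z' \<Longrightarrow> set ss \<subseteq> apps \<C> \<Longrightarrow> set us \<subseteq> apps \<C> \<Longrightarrow>
    (z = [] \<or> hd z = LBar) \<Longrightarrow> (z' = [] \<or> hd z' = LBar) \<Longrightarrow> ss = us \<and> z = z'"
proof (induction ss arbitrary: us)
  case Nil
  then show ?case by (cases us; cases z) auto
next
  case (Cons a ss)
  obtain c xs where a: "a = (c, xs)" by fastforce
  obtain ys us' where us: "us = (c, ys) # us'"
    using Cons.prems(1,5) a by (cases us; cases z') auto
  have nz: "no_digit z" "no_digit z'"
    using Cons.prems(4,5) by (cases z, simp_all) (cases z', simp_all)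
  have "enc_args xs @ (enc_apps ss @ z) = enc_args ys @ (enc_apps us' @ z')"
    using Cons.prems(1) a us by simp
  moreover have "length xs = length ys"
    using Cons.prems(2,3) a us by (auto simp: apps_def)
  ultimately have "xs = ys \<and> enc_apps ss @ z = enc_apps us' @ z'"
    by (rule enc_args_inj) (intro no_digit_enc_apps nz)+
  then show ?case using Cons.IH[of us'] Cons.prems a us by auto
qed

lemma LBar_notin_enc_args: "LBar \<notin> set (enc_args xs)"
proof -
  have "LBar \<notin> set (enc_arg x)" for x by (cases x) auto
  then show ?thesis by auto
qed

lemma LCon_notin_enc_args: "LCon c \<notin> set (enc_args xs)"
proof -
  have "LCon c \<notin> set (enc_arg x)" for x by (cases x) auto
  then show ?thesis by auto
qed

lemma LBar_notin_enc_apps: "LBar \<notin> set (enc_apps ss)"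
  using LBar_notin_enc_args by (induction ss) auto

lemma
  shows before_bar_enc_apps: "takeWhile (\<lambda>x. x \<noteq> LBar) (enc_apps ss @ LBar # w) = enc_apps ss"
    and after_bar_enc_apps: "after_bar (enc_apps ss @ LBar # w) = w"
proof -
  have "\<And>x. x \<in> set (enc_apps ss) \<Longrightarrow> x \<noteq> LBar"
    using LBar_notin_enc_apps by blast
  then show "takeWhile (\<lambda>x. x \<noteq> LBar) (enc_apps ss @ LBar # w) = enc_apps ss"
    "after_bar (enc_apps ss @ LBar # w) = w"
    by (simp_all add: after_bar_def)
qed

text \<open>Membership in the language quantifies over all encodings; unique decodability leaves
  only \<open>ss\<close>.\<close>

lemma CSP_c_enc_apps:
  assumes "set ss \<subseteq> apps \<C>"
  shows "enc_apps ss \<in> CSP_c \<C> \<longleftrightarrow> satisfiable (set ss)"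
  using assms enc_apps_inj[of _ "[]" _ "[]" \<C>] by (auto simp: CSP_c_def)

lemma EQUIV_c_enc_apps:
  assumes "set ss \<subseteq> apps \<C>" and "set us \<subseteq> apps \<C>"
  shows "enc_apps ss @ LBar # enc_apps us \<in> EQUIV_c \<C> \<longleftrightarrow> equivalent (set ss) (set us)"
proof
  assume "enc_apps ss @ LBar # enc_apps us \<in> EQUIV_c \<C>"
  then obtain ss' us' where *: "enc_apps ss @ LBar # enc_apps us = enc_apps ss' @ LBar # enc_apps us'"
    "set ss' \<subseteq> apps \<C>" "set us' \<subseteq> apps \<C>" "equivalent (set ss') (set us')"
    by (auto simp: EQUIV_c_def)
  from *(1) have "ss = ss' \<and> LBar # enc_apps us = LBar # enc_apps us'"
    by (rule enc_apps_inj) (use assms * in auto)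
  moreover from this have "us = us'"
    using enc_apps_inj[of us "[]" us' "[]" \<C>] assms * by simp
  ultimately show "equivalent (set ss) (set us)" using * by simp
qed (use assms in \<open>auto simp: EQUIV_c_def\<close>)

section \<open>Meaning of the queries\<close>

fun arg_subst :: "var \<Rightarrow> bool \<Rightarrow> arg \<Rightarrow> arg" where
  "arg_subst v b (Var v') = (if v' = v then Const b else Var v')"
| "arg_subst v b (Const b') = Const b'"

definition app_subst :: "var \<Rightarrow> bool \<Rightarrow> app \<Rightarrow> app" where
  "app_subst v b = map_prod id (map (arg_subst v b))"

lemma eval_arg_subst: "eval_arg \<alpha> (arg_subst v b x) = eval_arg (\<alpha>(v := b)) x"
  by (cases x) auto

lemma map_eval_arg_subst:
  "map (eval_arg \<alpha>) (map (arg_subst v b) xs) = map (eval_arg (\<alpha>(v := b))) xs"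
  by (simp add: eval_arg_subst)

lemma satisfies_app_subst:
  "satisfies \<alpha> (set (map (app_subst v b) ss)) \<longleftrightarrow> satisfies (\<alpha>(v := b)) (set ss)"
  by (auto simp: satisfies_def app_subst_def eval_arg_subst comp_def case_prod_unfold)

lemma apps_subst: "set ss \<subseteq> apps \<C> \<Longrightarrow> set (map (app_subst v b) ss) \<subseteq> apps \<C>"
  by (auto simp: apps_def app_subst_def)

lemma substitute_enc_args:
  "no_digit z \<Longrightarrow> substitute (map LDigit v) b (enc_args xs @ z) =
    enc_args (map (arg_subst v b) xs) @ substitute (map LDigit v) b z"
proof (induction xs)
  case (Cons x xs)
  note nd = no_digit_enc_args[OF Cons.prems, of xs]
  have "map LDigit v' = map LDigit v \<longleftrightarrow> v' = v" for v' :: var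
    by (auto dest: map_injective simp: inj_def)
  then show ?case
    using Cons by (cases x) (auto simp: digits_append[OF nd])
qed simp

lemma substitute_enc_apps:
  "no_digit z \<Longrightarrow> substitute (map LDigit v) b (enc_apps ss @ z) =
    enc_apps (map (app_subst v b) ss) @ substitute (map LDigit v) b z"
proof (induction ss)
  case (Cons a ss)
  obtain c xs where "a = (c, xs)" by fastforce
  then show ?case
    using Cons substitute_enc_args[OF no_digit_enc_apps[OF Cons.prems, of ss], of v b xs]
    by (simp add: app_subst_def)
qed simp

text \<open>Induction on the values still to be assigned, with all three lists generalised because a
  substitution changes each of them. Models of the substituted list correspond to models of the
  original one with the prescribed value.\<close>

lemma final_query_fold_assign_next:
  assumes "length xs = length a" and "set rs \<subseteq> apps \<C>" and "set ss \<subseteq> apps \<C>"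
  shows "(\<exists>q \<in> set (final_query (fold assign_next a (enc_args xs @ enc_apps rs @ LBar # enc_apps ss))).
      q \<in> CSP_c \<C>) \<longleftrightarrow> (\<exists>\<alpha>. map (eval_arg \<alpha>) xs = a \<and> satisfies \<alpha> (set ss))"
  using assms
proof (induction a arbitrary: xs rs ss)
  case Nil
  have "final_query (enc_apps rs @ LBar # enc_apps ss) = [enc_apps ss]"
    by (simp add: final_query_def after_bar_enc_apps)
  then show ?case
    using Nil CSP_c_enc_apps[of ss \<C>] by (auto simp: satisfiable_def)
next
  case (Cons b a)
  then obtain x xs' where xs: "xs = x # xs'" "length xs' = length a" by (cases xs) auto
  show ?case
  proof (cases x)
    case (Var v)
    let ?f = "map (arg_subst v b)" and ?g = "map (app_subst v b)"
    have nd: "no_digit (enc_apps rs @ LBar # enc_apps ss)"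
      by (rule no_digit_enc_apps) simp
    note nd' = no_digit_enc_args[OF nd, of xs']
    have "assign_next b (enc_args xs @ enc_apps rs @ LBar # enc_apps ss) =
        substitute (map LDigit v) b (enc_args xs' @ enc_apps rs @ LBar # enc_apps ss)"
      by (simp add: xs Var digits_append[OF nd'])
    also have "\<dots> = enc_args (?f xs') @ enc_apps (?g rs) @ LBar # enc_apps (?g ss)"
      using substitute_enc_apps[of "[]" v b ss]
      by (simp add: substitute_enc_args[OF nd] substitute_enc_apps)
    finally have "(\<exists>q \<in> set (final_query (fold assign_next (b # a)
          (enc_args xs @ enc_apps rs @ LBar # enc_apps ss))). q \<in> CSP_c \<C>) \<longleftrightarrow>
        (\<exists>\<alpha>. map (eval_arg \<alpha>) (?f xs') = a \<and> satisfies \<alpha> (set (?g ss)))"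
      using Cons.IH[of "?f xs'" "?g rs" "?g ss"] xs(2) apps_subst Cons.prems(2,3)
      by (simp del: map_map set_map)
    also have "\<dots> \<longleftrightarrow> (\<exists>\<alpha>. \<alpha> v = b \<and> map (eval_arg \<alpha>) xs' = a \<and> satisfies \<alpha> (set ss))"
      unfolding map_eval_arg_subst satisfies_app_subst
    \<comment> \<open>Updating at \<open>v\<close> gives any assignment the right value there;
      conversely, an assignment with \<open>\<alpha> v = b\<close> equals its own update.\<close>
    proof (intro iffI; elim exE conjE)
      fix \<alpha> assume "map (eval_arg (\<alpha>(v := b))) xs' = a" "satisfies (\<alpha>(v := b)) (set ss)"
      then show "\<exists>\<alpha>. \<alpha> v = b \<and> map (eval_arg \<alpha>) xs' = a \<and> satisfies \<alpha> (set ss)"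
        by (intro exI[of _ "\<alpha>(v := b)"]) simp
    next
      fix \<alpha> assume "\<alpha> v = b" "map (eval_arg \<alpha>) xs' = a" "satisfies \<alpha> (set ss)"
      then show "\<exists>\<alpha>. map (eval_arg (\<alpha>(v := b))) xs' = a \<and> satisfies (\<alpha>(v := b)) (set ss)"
        by (intro exI[of _ \<alpha>]) (auto simp: fun_upd_idem)
    qed
    also have "\<dots> \<longleftrightarrow> (\<exists>\<alpha>. map (eval_arg \<alpha>) xs = b # a \<and> satisfies \<alpha> (set ss))"
      by (simp add: xs Var)
    finally show ?thesis .
  next
    case (Const b')
    \<comment> \<open>A constant different from \<open>b\<close> erases the word, and later
      assignments keep it empty; then both sides are false.\<close>
    have "fold assign_next a [] = []" for a by (induction a) auto
    then show ?thesis
      using Cons.IH[of xs' rs ss] Cons.prems(2,3) xs Const by (auto simp: final_query_def)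
  qed
qed

lemma app_queries_skip: "LCon c \<notin> set z \<Longrightarrow> app_queries c a s (z @ u) = app_queries c a s u"
  by (induction z) auto

lemma app_queries_CSP_c:
  assumes "length a = arity c" and "set us \<subseteq> apps \<C>" and "set ss \<subseteq> apps \<C>"
  shows "(\<exists>q \<in> set (app_queries c a (enc_apps ss) (enc_apps us)). q \<in> CSP_c \<C>) \<longleftrightarrow>
    (\<exists>xs \<alpha>. (c, xs) \<in> set us \<and> map (eval_arg \<alpha>) xs = a \<and> satisfies \<alpha> (set ss))"
  using assms(2)
proof (induction us)
  case (Cons u us)
  obtain c' xs where u: "u = (c', xs)" by fastforce
  have "app_queries c a (enc_apps ss) (enc_apps (u # us)) =
      (if c' = c then final_query (fold assign_next a (enc_args xs @ enc_apps us @ LBar # enc_apps ss))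
       else []) @ app_queries c a (enc_apps ss) (enc_apps us)"
    using app_queries_skip[OF LCon_notin_enc_args] by (simp add: u)
  moreover have "c' = c \<Longrightarrow> length xs = length a"
    using Cons.prems assms(1) u by (auto simp: apps_def)
  ultimately show ?case
    using final_query_fold_assign_next[of xs a us \<C> ss] Cons u assms(3)
    by (auto simp: bex_Un)
qed simp

text \<open>An assignment that satisfies one list and falsifies an application in the other
  determines a tuple, the values of its arguments. The two halves of \<open>pair_queries\<close>
  account for the two directions of the equivalence.\<close>

lemma tt_queries_CSP_c:
  assumes "set cas = {(c, a). c \<in> \<C> \<and> length a = arity c \<and> \<not> eval_con c a}"
    and "set ss \<subseteq> apps \<C>" and "set us \<subseteq> apps \<C>"
  shows "(\<exists>q \<in> set (tt_queries cas (enc_apps ss @ LBar # enc_apps us)). q \<in> CSP_c \<C>) \<longleftrightarrow>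
    \<not> equivalent (set ss) (set us)"
proof -
  have half: "(\<exists>(c, a) \<in> set cas. \<exists>q \<in> set (app_queries c a (enc_apps ss) (enc_apps us)). q \<in> CSP_c \<C>) \<longleftrightarrow>
      (\<exists>\<alpha>. satisfies \<alpha> (set ss) \<and> \<not> satisfies \<alpha> (set us))" (is "?L \<longleftrightarrow> ?R")
    if "set ss \<subseteq> apps \<C>" "set us \<subseteq> apps \<C>" for ss us
  proof -
    have "?L \<longleftrightarrow> (\<exists>(c, a) \<in> set cas. \<exists>xs \<alpha>. (c, xs) \<in> set us \<and> map (eval_arg \<alpha>) xs = a \<and>
        satisfies \<alpha> (set ss))"
    proof (rule bex_cong[OF refl], clarify)
      fix c a assume "(c, a) \<in> set cas"
      then have "length a = arity c" by (simp add: assms(1))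
      from app_queries_CSP_c[OF this that(2,1)]
      show "(\<exists>q \<in> set (app_queries c a (enc_apps ss) (enc_apps us)). q \<in> CSP_c \<C>) \<longleftrightarrow>
        (\<exists>xs \<alpha>. (c, xs) \<in> set us \<and> map (eval_arg \<alpha>) xs = a \<and> satisfies \<alpha> (set ss))" .
    qed
    \<comment> \<open>The tuple \<open>a\<close> is eliminated: it can only be the values of
      \<open>xs\<close> under \<alpha>.\<close>
    also have "\<dots> \<longleftrightarrow> (\<exists>\<alpha>. satisfies \<alpha> (set ss) \<and>
        (\<exists>(c, xs) \<in> set us. (c, map (eval_arg \<alpha>) xs) \<in> set cas))"
      by blast
    also have "\<dots> \<longleftrightarrow> (\<exists>\<alpha>. satisfies \<alpha> (set ss) \<and>
        (\<exists>(c, xs) \<in> set us. \<not> eval_con c (map (eval_arg \<alpha>) xs)))"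
    proof -
      have "(c, map (eval_arg \<alpha>) xs) \<in> set cas \<longleftrightarrow> \<not> eval_con c (map (eval_arg \<alpha>) xs)"
        if "(c, xs) \<in> set us" for c xs \<alpha>
        using that \<open>set us \<subseteq> apps \<C>\<close> by (auto simp: assms(1) apps_def)
      then show ?thesis by blast
    qed
    also have "\<dots> \<longleftrightarrow> ?R"
      by (auto simp: satisfies_def)
    finally show ?thesis .
  qed
  have "(\<exists>q \<in> set (tt_queries cas (enc_apps ss @ LBar # enc_apps us)). q \<in> CSP_c \<C>) \<longleftrightarrow>
      (\<exists>(c, a) \<in> set cas. \<exists>q \<in> set (app_queries c a (enc_apps ss) (enc_apps us)). q \<in> CSP_c \<C>) \<or>
      (\<exists>(c, a) \<in> set cas. \<exists>q \<in> set (app_queries c a (enc_apps us) (enc_apps ss)). q \<in> CSP_c \<C>)"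
    unfolding tt_queries_def pair_queries_def Let_def case_prod_unfold before_bar_enc_apps after_bar_enc_apps by auto
  then show ?thesis
    using half[OF assms(2,3)] half[OF assms(3,2)] by (auto simp: equivalent_def)
qed

section \<open>The evaluator\<close>

text \<open>A state consists of the phase (0 and 1: before and after the bar, 2: reading the answers), the
  number of arguments still missing in the current constraint application, and whether a digit may
  follow.\<close>

type_synonym eval_state = "(nat \<times> nat \<times> bool) option"

fun eval_step :: "eval_state \<Rightarrow> letter symbol \<Rightarrow> eval_state" where
  "eval_step (Some (p, n, d)) (Letter (LDigit b)) = (if d then Some (p, n, True) else None)"
| "eval_step (Some (p, n, d)) (Letter (LConst b)) = (if n = 0 then None else Some (p, n - 1, False))"
| "eval_step (Some (p, n, d)) (Letter LVar) = (if n = 0 then None else Some (p, n - 1, True))"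
| "eval_step (Some (p, n, d)) (Letter (LCon c)) = (if n = 0 then Some (p, arity c, False) else None)"
| "eval_step (Some (p, n, d)) (Letter LBar) = (if p = 0 \<and> n = 0 then Some (1, 0, False) else None)"
| "eval_step (Some (p, n, d)) Sep = (if p = 1 \<and> n = 0 then Some (2, 0, False) else None)"
| "eval_step (Some (p, n, d)) (Bit False) = Some (p, n, d)"
| "eval_step _ _ = None"

abbreviation eval_word :: "eval_state \<Rightarrow> letter list \<Rightarrow> eval_state" where
  "eval_word q w \<equiv> foldl eval_step q (enc_word w)"

text \<open>Survival suffices for acceptance: the word contains \<open>Sep\<close>, which is passed
  only after a complete pair, and a positive answer leads to \<open>None\<close>.\<close>

definition verdict :: "letter list \<times> bool list \<Rightarrow> bool" where
  "verdict xbs = (foldl eval_step (Some (0, 0, False)) (enc_answers xbs) \<noteq> None)"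

lemma foldl_eval_step_None [simp]: "foldl eval_step None w = None"
  by (induction w) auto

lemma eval_word_simps [simp]:
  "eval_word q [] = q"
  "eval_word q (x # w) = eval_word (eval_step q (Letter x)) w"
  "eval_word q (v @ w) = eval_word (eval_word q v) w"
  by (simp_all add: enc_word_def)

lemma eval_word_args:
  "length xs \<le> n \<Longrightarrow> \<exists>d'. eval_word (Some (p, n, d)) (enc_args xs) = Some (p, n - length xs, d')"
proof (induction xs arbitrary: n d)
  case (Cons x xs)
  have "eval_word (Some (p, m, True)) (map LDigit v) = Some (p, m, True)" for m v
    by (induction v) auto
  then have "\<exists>d'. eval_word (Some (p, n, d)) (enc_arg x) = Some (p, n - 1, d')"
    using Cons.prems by (cases x) auto
  then show ?case using Cons.IH[of "n - 1"] Cons.prems by auto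
qed simp

lemma eval_word_apps:
  "set ss \<subseteq> apps \<C> \<Longrightarrow> \<exists>d'. eval_word (Some (p, 0, d)) (enc_apps ss) = Some (p, 0, d')"
proof (induction ss arbitrary: d)
  case (Cons a ss)
  obtain c xs where a: "a = (c, xs)" by fastforce
  obtain d' where "eval_word (Some (p, arity c, False)) (enc_args xs) = Some (p, 0, d')"
    using eval_word_args[of xs "arity c" p False] Cons.prems a by (auto simp: apps_def)
  then show ?case using Cons a by auto
qed simp

text \<open>A state is read as a promise about the remaining word: digits continuing a name if
  \<open>d\<close> holds, then \<open>n\<close> arguments, then applications, with a bar still to
  come exactly in phase 0.\<close>

lemma eval_word_sound:
  assumes "set w \<subseteq> alphabet \<C>" and "eval_word (Some (p, n, d)) w = Some (1, 0, d')" and "p \<le> 1"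
  shows "\<exists>ds xs us. length xs = n \<and> (\<not> d \<longrightarrow> ds = []) \<and> set us \<subseteq> apps \<C> \<and>
    (p = 1 \<and> w = map LDigit ds @ enc_args xs @ enc_apps us \<or>
     p = 0 \<and> (\<exists>ss. set ss \<subseteq> apps \<C> \<and>
       w = map LDigit ds @ enc_args xs @ enc_apps ss @ LBar # enc_apps us))"
  using assms
proof (induction w arbitrary: p n d)
  case Nil
  then show ?case by (intro exI[of _ "[] :: bool list"] exI[of _ "[] :: arg list"] exI[of _ "[] :: app list"]) auto
next
  case (Cons x w)
  have w: "set w \<subseteq> alphabet \<C>" using Cons.prems(1) by simp
  show ?case
  proof (cases x)
    case (LCon c)
    with Cons.prems have n: "n = 0" and r: "eval_word (Some (p, arity c, False)) w = Some (1, 0, d')"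
      by (auto split: if_splits)
    \<comment> \<open>The automaton does not check that the constraint belongs to \<C>; the alphabet
      guarantees it.\<close>
    have c: "c \<in> \<C>" using Cons.prems(1) LCon by (auto simp: alphabet_def)
    from Cons.IH[OF w r Cons.prems(3)] obtain xs us where *: "length xs = arity c"
      "set us \<subseteq> apps \<C>" "p = 1 \<and> w = enc_args xs @ enc_apps us \<or>
       p = 0 \<and> (\<exists>ss. set ss \<subseteq> apps \<C> \<and> w = enc_args xs @ enc_apps ss @ LBar # enc_apps us)"
      by auto
    have app: "(c, xs) \<in> apps \<C>" using c *(1) by (simp add: apps_def)
    from *(3) show ?thesis
    proof (elim disjE conjE exE)
      assume "p = 1" "w = enc_args xs @ enc_apps us"
      then show ?thesis using app * n LCon
        by (intro exI[of _ "[] :: bool list"] exI[of _ "[] :: arg list"] exI[of _ "(c, xs) # us"]) auto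
    next
      fix ss assume "p = 0" "set ss \<subseteq> apps \<C>" "w = enc_args xs @ enc_apps ss @ LBar # enc_apps us"
      then have "\<exists>ss. set ss \<subseteq> apps \<C> \<and> x # w = enc_apps ss @ LBar # enc_apps us"
        using app LCon by (intro exI[of _ "(c, xs) # ss"]) auto
      then show ?thesis using *(2) n \<open>p = 0\<close>
        by (intro exI[of _ "[] :: bool list"] exI[of _ "[] :: arg list"] exI[of _ us]) simp
    qed
  next
    case (LConst b)
    with Cons.prems have n: "n \<noteq> 0" and r: "eval_word (Some (p, n - 1, False)) w = Some (1, 0, d')"
      by (auto split: if_splits)
    from Cons.IH[OF w r Cons.prems(3)] obtain xs us where "length xs = n - 1"
      "set us \<subseteq> apps \<C>" "p = 1 \<and> w = enc_args xs @ enc_apps us \<or>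
       p = 0 \<and> (\<exists>ss. set ss \<subseteq> apps \<C> \<and> w = enc_args xs @ enc_apps ss @ LBar # enc_apps us)"
      by auto
    then show ?thesis using n LConst
      by (intro exI[of _ "[] :: bool list"] exI[of _ "Const b # xs"] exI[of _ us]) auto
  next
    case LVar
    with Cons.prems have n: "n \<noteq> 0" and r: "eval_word (Some (p, n - 1, True)) w = Some (1, 0, d')"
      by (auto split: if_splits)
    from Cons.IH[OF w r Cons.prems(3)] obtain ds xs us where "length xs = n - 1"
      "set us \<subseteq> apps \<C>" "p = 1 \<and> w = map LDigit ds @ enc_args xs @ enc_apps us \<or>
       p = 0 \<and> (\<exists>ss. set ss \<subseteq> apps \<C> \<and>
         w = map LDigit ds @ enc_args xs @ enc_apps ss @ LBar # enc_apps us)"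
      by auto
    \<comment> \<open>The digits promised after \<open>LVar\<close> become the name of the
      variable.\<close>
    then show ?thesis using n LVar
      by (intro exI[of _ "[] :: bool list"] exI[of _ "Var ds # xs"] exI[of _ us]) auto
  next
    case (LDigit b)
    with Cons.prems have d: "d" and r: "eval_word (Some (p, n, True)) w = Some (1, 0, d')"
      by (auto split: if_splits)
    from Cons.IH[OF w r Cons.prems(3)] obtain ds xs us where "length xs = n"
      "set us \<subseteq> apps \<C>" "p = 1 \<and> w = map LDigit ds @ enc_args xs @ enc_apps us \<or>
       p = 0 \<and> (\<exists>ss. set ss \<subseteq> apps \<C> \<and>
         w = map LDigit ds @ enc_args xs @ enc_apps ss @ LBar # enc_apps us)"
      by auto
    then show ?thesis using d LDigit
      by (intro exI[of _ "b # ds"] exI[of _ xs] exI[of _ us]) auto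
  next
    case LBar
    with Cons.prems have p: "p = 0" "n = 0" and r: "eval_word (Some (1, 0, False)) w = Some (1, 0, d')"
      by (auto split: if_splits)
    from Cons.IH[OF w r] obtain us where "set us \<subseteq> apps \<C>" "w = enc_apps us"
      by auto
    then show ?thesis using p LBar
      by (intro exI[of _ "[] :: bool list"] exI[of _ "[] :: arg list"] exI[of _ us]) (auto intro: exI[of _ "[]"])
  qed
qed

lemma verdict_iff:
  assumes "set x \<subseteq> alphabet \<C>"
  shows "verdict (x, bs) \<longleftrightarrow> True \<notin> set bs \<and>
    (\<exists>ss us. set ss \<subseteq> apps \<C> \<and> set us \<subseteq> apps \<C> \<and> x = enc_apps ss @ LBar # enc_apps us)"
proof -
  have bits: "foldl eval_step (Some q) (map Bit bs) \<noteq> None \<longleftrightarrow> True \<notin> set bs" for q bs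
  proof (induction bs)
    case (Cons b bs)
    then show ?case by (cases q; cases b) auto
  qed simp
  have bit_end: "eval_step q Sep = (if \<exists>d. q = Some (1, 0, d) then Some (2, 0, False) else None)" for q
    by (cases q) auto
  have "verdict (x, bs) \<longleftrightarrow>
      foldl eval_step (eval_step (eval_word (Some (0, 0, False)) x) Sep) (map Bit bs) \<noteq> None"
    by (simp add: verdict_def enc_answers_def)
  also have "\<dots> \<longleftrightarrow> True \<notin> set bs \<and> (\<exists>d. eval_word (Some (0, 0, False)) x = Some (1, 0, d))"
    using bits by (simp add: bit_end)
  also have "(\<exists>d. eval_word (Some (0, 0, False)) x = Some (1, 0, d)) \<longleftrightarrow>
    (\<exists>ss us. set ss \<subseteq> apps \<C> \<and> set us \<subseteq> apps \<C> \<and> x = enc_apps ss @ LBar # enc_apps us)"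
  proof
    assume "\<exists>d. eval_word (Some (0, 0, False)) x = Some (1, 0, d)"
    then show "\<exists>ss us. set ss \<subseteq> apps \<C> \<and> set us \<subseteq> apps \<C> \<and> x = enc_apps ss @ LBar # enc_apps us"
      using eval_word_sound[OF assms, of 0 0 False] by fastforce
  next
    assume "\<exists>ss us. set ss \<subseteq> apps \<C> \<and> set us \<subseteq> apps \<C> \<and> x = enc_apps ss @ LBar # enc_apps us"
    then obtain ss us where *: "set ss \<subseteq> apps \<C>" "set us \<subseteq> apps \<C>"
      "x = enc_apps ss @ LBar # enc_apps us" by blast
    from eval_word_apps[OF *(1), of 0 False] eval_word_apps[OF *(2), of 1 False]
    show "\<exists>d. eval_word (Some (0, 0, False)) x = Some (1, 0, d)" unfolding *(3) by auto
  qed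
  finally show ?thesis .
qed


text \<open>An ill-formed word lies outside the language and is rejected for its syntax, whatever
  the answers are.\<close>

lemma tt_queries_reduce:
  assumes "set cas = {(c, a). c \<in> \<C> \<and> length a = arity c \<and> \<not> eval_con c a}"
    and "set x \<subseteq> alphabet \<C>"
  shows "x \<in> EQUIV_c \<C> \<longleftrightarrow> verdict (x, map (\<lambda>y. y \<in> CSP_c \<C>) (tt_queries cas x))"
proof (cases "\<exists>ss us. set ss \<subseteq> apps \<C> \<and> set us \<subseteq> apps \<C> \<and> x = enc_apps ss @ LBar # enc_apps us")
  case True
  then obtain ss us where *: "set ss \<subseteq> apps \<C>" "set us \<subseteq> apps \<C>"
    "x = enc_apps ss @ LBar # enc_apps us" by blast
  then show ?thesis
    using tt_queries_CSP_c[OF assms(1) *(1,2)] EQUIV_c_enc_apps[OF *(1,2)]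
      verdict_iff[OF assms(2), of "map (\<lambda>y. y \<in> CSP_c \<C>) (tt_queries cas x)"] True
    by auto
next
  case False
  then show ?thesis using verdict_iff[OF assms(2)] by (auto simp: EQUIV_c_def)
qed

section \<open>The query generator\<close>

abbreviation digits :: "letter symbol set" where
  "digits \<equiv> Letter ` Collect is_digit"

lemma enc_queries_append [simp]: "enc_queries (xs @ ys) = enc_queries xs @ enc_queries ys"
  by (simp add: enc_queries_def)

lemma enc_queries_simps [simp]: "enc_queries [] = []" "enc_queries [y] = map Letter y @ [Sep]"
  by (simp_all add: enc_queries_def enc_word_def)

lemma set_enc_queries: "set ys \<subseteq> lists \<Sigma> \<Longrightarrow> set (enc_queries ys) \<subseteq> insert Sep (Letter ` \<Sigma>)"
  by (induction ys) (auto simp: enc_queries_def enc_word_def)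

lemma top_sym_drop_digits: "top_sym (map Letter (dropWhile is_digit r)) \<notin> digits"
  by (induction r) auto

lemma drop_to_bar:
  "dropWhile (\<lambda>x. x \<noteq> LBar) w = (if LBar \<in> set w then LBar # after_bar w else [])"
  unfolding after_bar_def by (induction w) auto

lemma length_fold_assign_next: "length (fold assign_next a w) \<le> length w"
proof (induction a arbitrary: w)
  case (Cons b a)
  show ?case using Cons[of "assign_next b w"] length_assign_next[of b w] by simp
qed simp

lemma length_after_bar: "length (after_bar w) \<le> length w"
  using length_dropWhile_le[of "\<lambda>x. x \<noteq> LBar" w] by (simp add: after_bar_def)

text \<open>The scanned letter makes room for the inserted bar, so the word worked on stays within
  \<open>M\<close>; the closing \<open>Sep\<close> comes on top.\<close>

lemma length_app_queries:
  "length u + length s \<le> M \<Longrightarrow> length (enc_queries (app_queries c a s u)) \<le> length u * (M + 2)"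
proof (induction u)
  case (Cons x r)
  let ?w = "fold assign_next a (r @ LBar # s)"
  have "length (enc_queries (final_query ?w)) \<le> length ?w + 1"
    using length_after_bar[of ?w] by (auto simp: final_query_def)
  also have "\<dots> \<le> M + 2"
    using length_fold_assign_next[of a "r @ LBar # s"] Cons.prems by simp
  finally show ?case using Cons by auto
qed simp

lemma length_tt_queries:
  "length (enc_queries (tt_queries cas w)) \<le> length cas * (length w * (length w + 2))"
proof (induction cas)
  case (Cons ca cas)
  obtain c a where ca: "ca = (c, a)" by fastforce
  let ?s = "takeWhile (\<lambda>x. x \<noteq> LBar) w" and ?u = "after_bar w"
  have "length ?s + length (dropWhile (\<lambda>x. x \<noteq> LBar) w) = length w"
    by (metis length_append takeWhile_dropWhile_id)
  then have len: "length ?s + length ?u \<le> length w" by (simp add: after_bar_def)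
  have "length (enc_queries (pair_queries ca w)) \<le> length ?u * (length w + 2) + length ?s * (length w + 2)"
    using length_app_queries[of ?u ?s "length w" c a] length_app_queries[of ?s ?u "length w" c a] len
    by (simp add: ca pair_queries_def Let_def)
  also have "\<dots> = (length ?s + length ?u) * (length w + 2)"
    by (simp only: add_mult_distrib add.commute)
  also have "\<dots> \<le> length w * (length w + 2)"
    using len by (rule mult_le_mono1)
  finally show ?case using Cons by (simp add: tt_queries_def)
qed (simp add: tt_queries_def)

text \<open>This is where the comparison of two names stops: \<open>ps\<close> is the part that
  \<open>match_cmd\<close> consumes.\<close>

lemma common_prefix_split:
  "\<exists>ps xs' ys'. xs = ps @ xs' \<and> ys = ps @ ys' \<and> (xs' = [] \<or> ys' = [] \<or> hd xs' \<noteq> hd ys')"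
proof (induction xs arbitrary: ys)
  case (Cons x xs)
  show ?case
  proof (cases "ys \<noteq> [] \<and> hd ys = x")
    case True
    then obtain ys0 where "ys = x # ys0" by (cases ys) auto
    with Cons[of ys0] show ?thesis by (metis append_Cons)
  next
    case False
    then have "x # xs = [] @ (x # xs) \<and> ys = [] @ ys \<and> (x # xs = [] \<or> ys = [] \<or> hd (x # xs) \<noteq> hd ys)"
      by auto
    then show ?thesis by blast
  qed
qed auto

text \<open>
  Use of the stacks: 0 input and output; 1, 2 the two lists; 3 the rest of the list searched for
  applications; 4 the word worked on; 5 the variable substituted and 6 the part of it already
  matched (reversed); 7 auxiliary; 8 the output (reversed).
\<close>

locale query_machine = stack_machine 9 \<Gamma> for \<Gamma> :: "letter symbol set" +
  fixes \<Sigma> :: "letter set"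
  assumes symbols_eq: "\<Gamma> = insert Blank (insert Sep (Letter ` \<Sigma>))"
    and special_letters: "LVar \<in> \<Sigma>" "LBar \<in> \<Sigma>" "LConst b \<in> \<Sigma>"
begin

lemma letters_in: "set xs \<subseteq> \<Sigma> \<Longrightarrow> set (map Letter xs) \<subseteq> \<Gamma> - {Blank}"
  by (auto simp: symbols_eq)

lemma Letter_in [simp]: "x \<in> \<Sigma> \<Longrightarrow> Letter x \<in> \<Gamma>"
  by (simp add: symbols_eq)

text \<open>The test for a digit also ends the loop when both stacks are exhausted, where the tops
  agree as blanks.\<close>

definition match_cmd :: "letter cmd" where
  "match_cmd = Loop (\<lambda>t. t 4 \<in> digits \<and> t 4 = t 5) (Seq (move 4 7) (move 5 6))"

text \<open>The variable goes to the output already during the comparison. If both names end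
  together, its digits and marker are taken back and the constant is written; otherwise the
  remaining digits follow. The last move restores the name on stack 5.\<close>

definition replace_cmd :: "bool \<Rightarrow> letter cmd" where
  "replace_cmd b = Seq (move 4 7) (Seq match_cmd (Seq
     (Cond (\<lambda>t. t 4 \<notin> digits \<and> t 5 = Blank)
       (Seq (drop_while digits 7) (Seq (Pop 7) (push 7 (\<lambda>_. Letter (LConst b)))))
       (move_while digits 4 7))
     (move_while (- {Blank}) 6 5)))"

definition substitute_cmd :: "bool \<Rightarrow> letter cmd" where
  "substitute_cmd b =
     Seq (Loop (\<lambda>t. t 4 \<noteq> Blank) (Cond (\<lambda>t. t 4 = Letter LVar) (replace_cmd b) (move 4 7)))
       (move_while (- {Blank}) 7 4)"

text \<open>The name passes through stack 6 because a move reverses it. Stack 5 is emptied at the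
  end, as the next assignment expects.\<close>

definition assign_cmd :: "bool \<Rightarrow> letter cmd" where
  "assign_cmd b = Cond (\<lambda>t. t 4 = Letter LVar)
     (Seq (Pop 4) (Seq (move_while digits 4 6) (Seq (move_while (- {Blank}) 6 5)
       (Seq (substitute_cmd b) (drop_while (- {Blank}) 5)))))
     (Cond (\<lambda>t. t 4 = Letter (LConst b)) (Pop 4) (drop_while (- {Blank}) 4))"

fun assigns_cmd :: "bool list \<Rightarrow> letter cmd" where
  "assigns_cmd [] = Skip"
| "assigns_cmd (b # a) = Seq (assign_cmd b) (assigns_cmd a)"

definition final_cmd :: "letter cmd" where
  "final_cmd = Seq (drop_while (- {Blank, Letter LBar}) 4)
     (Cond (\<lambda>t. t 4 = Letter LBar)
       (Seq (Pop 4) (Seq (move_while (- {Blank}) 4 8) (push 8 (\<lambda>_. Sep)))) Skip)"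

text \<open>A stack grows at its front, so the other list is copied first, then the bar is pushed,
  and the rest of the searched list comes last.\<close>

definition app_cmd :: "con \<Rightarrow> bool list \<Rightarrow> nat \<Rightarrow> letter cmd" where
  "app_cmd c a i = Loop (\<lambda>t. t 3 \<noteq> Blank) (Cond (\<lambda>t. t 3 = Letter (LCon c))
     (Seq (Pop 3) (Seq (copy i 4 7) (Seq (push 4 (\<lambda>_. Letter LBar)) (Seq (copy 3 4 7)
       (Seq (assigns_cmd a) final_cmd)))))
     (Pop 3))"

definition pair_cmd :: "con \<times> bool list \<Rightarrow> letter cmd" where
  "pair_cmd = (\<lambda>(c, a). Seq (copy 2 3 7) (Seq (app_cmd c a 1) (Seq (copy 1 3 7) (app_cmd c a 2))))"

fun pairs_cmd :: "(con \<times> bool list) list \<Rightarrow> letter cmd" where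
  "pairs_cmd [] = Skip"
| "pairs_cmd (ca # cas) = Seq (pair_cmd ca) (pairs_cmd cas)"

text \<open>Without a bar, \<open>Pop\<close> meets an empty stack and leaves it empty, in
  accordance with \<open>after_bar\<close>.\<close>

definition split_cmd :: "letter cmd" where
  "split_cmd = Seq (move_while (- {Blank, Letter LBar}) 0 7) (Seq (Pop 0)
     (Seq (move_while (- {Blank}) 7 1) (Seq (move_while (- {Blank}) 0 7) (move_while (- {Blank}) 7 2))))"

definition tt_cmd :: "(con \<times> bool list) list \<Rightarrow> letter cmd" where
  "tt_cmd cas = Seq split_cmd (Seq (pairs_cmd cas) (move_while (- {Blank}) 8 0))"

section \<open>Correctness and running times of the generator's programs\<close>

lemma run_match_cmd:
  assumes "set ps \<subseteq> Collect is_digit \<inter> \<Sigma>"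
    and "xs = [] \<or> ys = [] \<or> \<not> is_digit (hd xs) \<or> hd xs \<noteq> hd ys"
    and "\<sigma> 4 = map Letter (ps @ xs)" and "\<sigma> 5 = map Letter (ps @ ys)"
  shows "run match_cmd (12 * length ps + 1) \<sigma> (\<sigma>(4 := map Letter xs, 5 := map Letter ys,
    6 := rev (map Letter ps) @ \<sigma> 6, 7 := rev (map Letter ps) @ \<sigma> 7))"
  using assms(1,3,4)
proof (induction ps arbitrary: \<sigma>)
  case Nil
  then show ?case
    unfolding match_cmd_def using assms(2)
    by (intro run_eq[OF run_Loop_False]) (auto simp: tops_def top_sym_def hd_map)
next
  case (Cons p ps)
  let ?\<sigma>' = "\<sigma>(4 := map Letter (ps @ xs), 7 := Letter p # \<sigma> 7, 5 := map Letter (ps @ ys),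
    6 := Letter p # \<sigma> 6)"
  have 1: "run (Seq (move 4 7) (move 5 6)) 11 \<sigma> ?\<sigma>'"
    using Cons.prems by (intro run_seq[OF run_move run_eq[OF run_move]]) auto
  have 2: "run match_cmd (12 * length ps + 1) ?\<sigma>' (\<sigma>(4 := map Letter xs, 5 := map Letter ys,
      6 := rev (map Letter (p # ps)) @ \<sigma> 6, 7 := rev (map Letter (p # ps)) @ \<sigma> 7))"
    using Cons.prems by (intro run_eq[OF Cons.IH]) (auto simp: fun_eq_iff)
  show ?case
    unfolding match_cmd_def
    by (rule run_loop_step[OF _ 1 2[unfolded match_cmd_def]])
      (use Cons.prems in \<open>auto simp: tops_def\<close>)
qed

lemma run_replace_cmd:
  fixes r v :: "letter list"
  defines "ds \<equiv> takeWhile is_digit r"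
  assumes "\<sigma> 4 = Letter LVar # map Letter r" and "\<sigma> 5 = map Letter v" and "\<sigma> 6 = []"
    and "set r \<subseteq> \<Sigma>"
  shows "run (replace_cmd b) (20 * length r + 30) \<sigma>
    (\<sigma>(4 := map Letter (dropWhile is_digit r),
       7 := rev (map Letter (if ds = v then [LConst b] else LVar # ds)) @ \<sigma> 7))"
proof -
  define z where "z = dropWhile is_digit r"
  have r: "r = ds @ z" by (simp add: ds_def z_def)
  have z: "z = [] \<or> \<not> is_digit (hd z)" unfolding z_def using hd_dropWhile[of is_digit r] by blast
  have ds: "set ds \<subseteq> Collect is_digit \<inter> \<Sigma>"
    using assms(5) by (auto simp: ds_def dest: set_takeWhileD)
  obtain ps xs ys where sp: "ds = ps @ xs" "v = ps @ ys" "xs = [] \<or> ys = [] \<or> hd xs \<noteq> hd ys"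
    using common_prefix_split[of ds v] by blast
  have len: "length r = length ps + length xs + length z" by (simp add: r sp)
  let ?P = "map Letter ps"
  let ?s1 = "\<sigma>(4 := map Letter r, 7 := Letter LVar # \<sigma> 7)"
  let ?s2 = "\<sigma>(4 := map Letter (xs @ z), 5 := map Letter ys, 6 := rev ?P, 7 := rev ?P @ Letter LVar # \<sigma> 7)"
  let ?out = "rev (map Letter (if ds = v then [LConst b] else LVar # ds)) @ \<sigma> 7"
  let ?s3 = "\<sigma>(4 := map Letter z, 5 := map Letter ys, 6 := rev ?P, 7 := ?out)"
  have 1: "run (move 4 7) 5 \<sigma> ?s1"
    using assms special_letters by (intro run_move) auto
  have 2: "run match_cmd (12 * length ps + 1) ?s1 ?s2"
    using ds sp z assms(3,4)
    by (intro run_eq[OF run_match_cmd[where ps = ps and xs = "xs @ z" and ys = ys]])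
      (auto simp: r fun_eq_iff hd_append)
  have "xs = [] \<and> ys = [] \<longleftrightarrow> ds = v"
    using sp by auto
  \<comment> \<open>The rest \<open>z\<close> does not begin with a digit, so a digit on top of
    stack 4 stems from \<open>xs\<close>.\<close>
  moreover have "tops ?s2 4 \<in> digits \<longleftrightarrow> xs \<noteq> []"
    using ds sp z by (cases xs; cases z) (auto simp: tops_def)
  moreover have "tops ?s2 5 = Blank \<longleftrightarrow> ys = []"
    by (cases ys) (auto simp: tops_def)
  ultimately have cond: "tops ?s2 4 \<notin> digits \<and> tops ?s2 5 = Blank \<longleftrightarrow> ds = v"
    by auto
  have 3: "run (Cond (\<lambda>t. t 4 \<notin> digits \<and> t 5 = Blank)
       (Seq (drop_while digits 7) (Seq (Pop 7) (push 7 (\<lambda>_. Letter (LConst b)))))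
       (move_while digits 4 7)) (2 * length ps + 6 * length xs + 12) ?s2 ?s3"
  proof (rule run_cond)
    assume "tops ?s2 4 \<notin> digits \<and> tops ?s2 5 = Blank"
    then have "ds = v" using cond by simp
    then have "xs = []" using sp by auto
    show "run (Seq (drop_while digits 7) (Seq (Pop 7) (push 7 (\<lambda>_. Letter (LConst b)))))
        (2 * length ps + 6 * length xs + 11) ?s2 ?s3"
      using ds sp special_letters \<open>ds = v\<close> \<open>xs = []\<close>
      by (intro run_seq[OF run_drop_while[where xs = "rev ?P" and ys = "Letter LVar # \<sigma> 7"]
            run_seq[OF run_Pop run_eq[OF run_push[where s = "Letter (LConst b)"]]]])
        (auto simp: fun_eq_iff)
  next
    assume "\<not> (tops ?s2 4 \<notin> digits \<and> tops ?s2 5 = Blank)"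
    then have ne: "ds \<noteq> v" using cond by blast
    have "top_sym (map Letter z) \<notin> digits"
      using z by (cases z) auto
    then show "run (move_while digits 4 7) (2 * length ps + 6 * length xs + 11) ?s2 ?s3"
      using ds sp(1) ne
      by (intro run_eq[OF run_move_while[where xs = "map Letter xs" and ys = "map Letter z"]])
        (auto simp: fun_eq_iff)
  qed simp
  have 4: "run (move_while (- {Blank}) 6 5) (6 * length ps + 1) ?s3
      (\<sigma>(4 := map Letter z, 7 := ?out))"
    using ds sp assms(3,4)
    by (intro run_eq[OF run_move_all]) (auto simp: fun_eq_iff)
  show ?thesis
    unfolding replace_cmd_def z_def[symmetric]
    by (rule run_seq[OF 1 run_seq[OF 2 run_seq[OF 3 4 lessI] lessI]]) (simp add: len)
qed

text \<open>\<open>M\<close> stays fixed during the induction, so all rounds have the same budget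
  \<open>20 * M + 35\<close>, and each removes at least one letter.\<close>

lemma run_substitute_loop:
  assumes "\<sigma> 4 = map Letter w" and "\<sigma> 5 = map Letter v" and "\<sigma> 6 = []" and "set w \<subseteq> \<Sigma>"
    and "length w \<le> M"
  shows "run (Loop (\<lambda>t. t 4 \<noteq> Blank) (Cond (\<lambda>t. t 4 = Letter LVar) (replace_cmd b) (move 4 7)))
    (length w * (20 * M + 35) + 1) \<sigma> (\<sigma>(4 := [], 7 := rev (map Letter (substitute v b w)) @ \<sigma> 7))"
  using assms
proof (induction v b w arbitrary: \<sigma> rule: substitute.induct)
  case (1 v b)
  then show ?case by (intro run_eq[OF run_Loop_False]) (auto simp: tops_def)
next
  case (2 v b x r)
  let ?L = "Loop (\<lambda>t. t 4 \<noteq> Blank) (Cond (\<lambda>t. t 4 = Letter LVar) (replace_cmd b) (move 4 7))"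
  have ne: "tops \<sigma> 4 \<noteq> Blank" using 2(3) by (simp add: tops_def)
  show ?case
  proof (cases "x = LVar")
    case True
    let ?z = "dropWhile is_digit r"
    let ?out = "if takeWhile is_digit r = v then [LConst b] else LVar # takeWhile is_digit r"
    let ?s = "\<sigma>(4 := map Letter ?z, 7 := rev (map Letter ?out) @ \<sigma> 7)"
    have 1: "run (Cond (\<lambda>t. t 4 = Letter LVar) (replace_cmd b) (move 4 7)) (20 * M + 33) \<sigma> ?s"
      using 2 True run_replace_cmd[of \<sigma> r v b]
      by (intro run_mono[OF run_Cond_True[where n = "20 * length r + 30"]]) (auto simp: tops_def)
    have "set ?z \<subseteq> \<Sigma>" using 2(6) by (auto dest: set_dropWhileD)
    moreover have zl: "length ?z \<le> length r" by (rule length_dropWhile_le)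
    ultimately have 3: "run ?L (length ?z * (20 * M + 35) + 1) ?s
        (\<sigma>(4 := [], 7 := rev (map Letter (substitute v b (x # r))) @ \<sigma> 7))"
      using 2 True by (intro run_eq[OF 2(1)]) (auto simp: fun_eq_iff)
    have "length ?z * (20 * M + 35) \<le> length r * (20 * M + 35)"
      using zl by (rule mult_le_mono1)
    then have "20 * M + 33 + (length ?z * (20 * M + 35) + 1) < length (x # r) * (20 * M + 35) + 1"
    proof -
      have "20 * M + 33 + (i * B + 1) < B + j * B + 1" if "i * B \<le> j * B" "B = 20 * M + 35" for i j B
        using that by linarith
      with \<open>length ?z * (20 * M + 35) \<le> length r * (20 * M + 35)\<close> show ?thesis
        by (simp only: list.size add_Suc_right add_0_right mult_Suc)
    qed
    then show ?thesis
      by (rule run_loop_step[OF _ 1 3, rotated]) (rule ne)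
  next
    case False
    let ?s = "\<sigma>(4 := map Letter r, 7 := Letter x # \<sigma> 7)"
    have 1: "run (Cond (\<lambda>t. t 4 = Letter LVar) (replace_cmd b) (move 4 7)) 6 \<sigma> ?s"
      using 2 False by (intro run_mono[OF run_Cond_False[OF _ run_move]]) (auto simp: tops_def)
    have 3: "run ?L (length r * (20 * M + 35) + 1) ?s
        (\<sigma>(4 := [], 7 := rev (map Letter (substitute v b (x # r))) @ \<sigma> 7))"
      using 2 False by (intro run_eq[OF 2(2)]) (auto simp: fun_eq_iff)
    show ?thesis
      by (intro run_loop_step[OF _ 1 3]) (use ne in auto)
  qed
qed

lemma run_substitute_cmd:
  assumes "\<sigma> 4 = map Letter w" and "\<sigma> 5 = map Letter v" and "\<sigma> 6 = []" and "\<sigma> 7 = []"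
    and "set w \<subseteq> \<Sigma>"
  shows "run (substitute_cmd b) (50 * (length w + 1)\<^sup>2) \<sigma> (\<sigma>(4 := map Letter (substitute v b w)))"
proof -
  have "set (substitute v b w) \<subseteq> \<Sigma>"
    using set_substitute[of v b w] assms(5) special_letters by blast
  then have "run (move_while (- {Blank}) 7 4) (6 * length w + 1)
      (\<sigma>(4 := [], 7 := rev (map Letter (substitute v b w)) @ \<sigma> 7))
      (\<sigma>(4 := map Letter (substitute v b w)))"
    using length_substitute[of v b w] assms(4) letters_in
    by (intro run_eq[OF run_move_all]) (auto simp: fun_eq_iff)
  then show ?thesis
    unfolding substitute_cmd_def
    by (rule run_seq[OF run_substitute_loop[OF assms(1-3,5) order_refl]])
      (simp add: power2_eq_square algebra_simps)
qed

lemma run_assign_cmd: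
  assumes "\<sigma> 4 = map Letter w" and "\<sigma> 5 = []" and "\<sigma> 6 = []" and "\<sigma> 7 = []" and "set w \<subseteq> \<Sigma>"
  shows "run (assign_cmd b) (100 * (length w + 1)\<^sup>2) \<sigma> (\<sigma>(4 := map Letter (assign_next b w)))"
proof (cases "\<exists>r. w = LVar # r")
  case True
  then obtain r where w: "w = LVar # r" by blast
  let ?v = "takeWhile is_digit r" and ?z = "dropWhile is_digit r"
  have r: "map Letter r = map Letter ?v @ map Letter ?z"
    by (metis map_append takeWhile_dropWhile_id)
  have v: "set ?v \<subseteq> \<Sigma>" "set ?v \<subseteq> Collect is_digit" and z: "set ?z \<subseteq> \<Sigma>"
    using assms(5) w by (auto dest: set_takeWhileD set_dropWhileD)
  have top: "top_sym (map Letter ?z) \<notin> digits"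
    by (rule top_sym_drop_digits)
  have len: "length ?v \<le> length r" "length ?z \<le> length r"
    by (simp_all add: length_takeWhile_le length_dropWhile_le)
  let ?s1 = "\<sigma>(4 := map Letter r)"
  let ?s2 = "\<sigma>(4 := map Letter ?z, 6 := rev (map Letter ?v))"
  let ?s3 = "\<sigma>(4 := map Letter ?z, 5 := map Letter ?v)"
  let ?s4 = "\<sigma>(4 := map Letter (assign_next b w), 5 := map Letter ?v)"
  have 1: "run (Pop 4) 1 \<sigma> ?s1"
    using assms(1) w by (intro run_eq[OF run_Pop]) auto
  have 2: "run (move_while digits 4 6) (6 * length r + 1) ?s1 ?s2"
    using v top assms(3) r len
    by (intro run_eq[OF run_move_while[where xs = "map Letter ?v" and ys = "map Letter ?z"]])
      (auto simp: fun_eq_iff)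
  have 3: "run (move_while (- {Blank}) 6 5) (6 * length r + 1) ?s2 ?s3"
    using v assms(2,3) len letters_in[OF v(1)]
    by (intro run_eq[OF run_move_all]) (auto simp: fun_eq_iff)
  have "(length ?z + 1)\<^sup>2 \<le> (length r + 1)\<^sup>2" using len by (intro power_mono) auto
  then have 4: "run (substitute_cmd b) (50 * (length r + 1)\<^sup>2) ?s3 ?s4"
    using z assms(3,4) w
    by (intro run_eq[OF run_substitute_cmd[where w = ?z and v = ?v]]) (auto simp: fun_eq_iff)
  have 5: "run (drop_while (- {Blank}) 5) (2 * length r + 1) ?s4
      (\<sigma>(4 := map Letter (assign_next b w)))"
    using assms(2) len
    by (intro run_eq[OF run_drop_while[where xs = "map Letter ?v" and ys = "[]"]]) (auto simp: fun_eq_iff)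
  have "run (Seq (Pop 4) (Seq (move_while digits 4 6) (Seq (move_while (- {Blank}) 6 5)
       (Seq (substitute_cmd b) (drop_while (- {Blank}) 5)))))
      (50 * (length r + 1)\<^sup>2 + 14 * length r + 20) \<sigma> (\<sigma>(4 := map Letter (assign_next b w)))"
    by (rule run_seq[OF 1 run_seq[OF 2 run_seq[OF 3 run_seq[OF 4 5 lessI] lessI] lessI]]) simp
  then show ?thesis
    unfolding assign_cmd_def
    by (intro run_mono[OF run_Cond_True])
      (auto simp: tops_def assms(1) w power2_eq_square algebra_simps)
next
  case False
  have nv: "tops \<sigma> 4 \<noteq> Letter LVar"
    using False assms(1) by (cases w) (auto simp: tops_def)
  have inner: "run (Cond (\<lambda>t. t 4 = Letter (LConst b)) (Pop 4) (drop_while (- {Blank}) 4))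
      (2 * length w + 2) \<sigma> (\<sigma>(4 := map Letter (assign_next b w)))"
  proof (rule run_cond)
    assume "tops \<sigma> 4 = Letter (LConst b)"
    then obtain r where "w = LConst b # r"
      using assms(1) by (cases w) (auto simp: tops_def)
    then show "run (Pop 4) (2 * length w + 1) \<sigma> (\<sigma>(4 := map Letter (assign_next b w)))"
      using assms(1) by (intro run_eq[OF run_Pop]) auto
  next
    assume "tops \<sigma> 4 \<noteq> Letter (LConst b)"
    then have "assign_next b w = []"
      using assms(1) False by (cases "(b, w)" rule: assign_next.cases) (auto simp: tops_def)
    then show "run (drop_while (- {Blank}) 4) (2 * length w + 1) \<sigma> (\<sigma>(4 := map Letter (assign_next b w)))"
      using assms(1)
      by (intro run_eq[OF run_drop_while[where xs = "map Letter w" and ys = "[]"]]) auto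
  qed simp
  show ?thesis
    unfolding assign_cmd_def
    by (rule run_mono[OF run_Cond_False[where P = "\<lambda>t. t 4 = Letter LVar", OF nv inner]]) (simp add: power2_eq_square algebra_simps)
qed

lemma run_assigns_cmd:
  assumes "\<sigma> 4 = map Letter w" and "\<sigma> 5 = []" and "\<sigma> 6 = []" and "\<sigma> 7 = []" and "set w \<subseteq> \<Sigma>"
    and "length w \<le> M"
  shows "run (assigns_cmd a) (length a * (100 * (M + 1)\<^sup>2 + 1) + 1) \<sigma>
    (\<sigma>(4 := map Letter (fold assign_next a w)))"
  using assms
proof (induction a arbitrary: w \<sigma>)
  case Nil
  then show ?case by (intro run_eq[OF run_Skip[folded assigns_cmd.simps(1)]]) auto
next
  case (Cons b a)
  have "(length w + 1)\<^sup>2 \<le> (M + 1)\<^sup>2" using Cons.prems by (intro power_mono) auto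
  then have 1: "run (assign_cmd b) (100 * (M + 1)\<^sup>2) \<sigma> (\<sigma>(4 := map Letter (assign_next b w)))"
    using Cons.prems by (intro run_mono[OF run_assign_cmd]) auto
  have "set (assign_next b w) \<subseteq> \<Sigma>"
    using set_assign_next[of b w] Cons.prems special_letters by blast
  then have 2: "run (assigns_cmd a) (length a * (100 * (M + 1)\<^sup>2 + 1) + 1)
      (\<sigma>(4 := map Letter (assign_next b w))) (\<sigma>(4 := map Letter (fold assign_next (b # a) w)))"
    using Cons.prems length_assign_next[of b w]
    by (intro run_eq[OF Cons.IH[of _ "assign_next b w"]]) auto
  show ?case
    unfolding assigns_cmd.simps by (rule run_seq[OF 1 2]) simp
qed

lemma run_final_cmd:
  assumes "\<sigma> 4 = map Letter w" and "set w \<subseteq> \<Sigma>"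
  shows "run final_cmd (10 * length w + 20) \<sigma>
    (\<sigma>(4 := [], 8 := rev (enc_queries (final_query w)) @ \<sigma> 8))"
proof -
  let ?v = "takeWhile (\<lambda>x. x \<noteq> LBar) w" and ?z = "dropWhile (\<lambda>x. x \<noteq> LBar) w"
  have w: "map Letter w = map Letter ?v @ map Letter ?z"
    by (metis map_append takeWhile_dropWhile_id)
  have z: "?z = (if LBar \<in> set w then LBar # after_bar w else [])"
    by (rule drop_to_bar)
  have len: "length ?v + length ?z = length w"
    by (metis length_append takeWhile_dropWhile_id)
  let ?s1 = "\<sigma>(4 := map Letter ?z)"
  have "top_sym (map Letter ?z) \<in> {Blank, Letter LBar}"
    unfolding z by simp
  then have 1: "run (drop_while (- {Blank, Letter LBar}) 4) (2 * length ?v + 1) \<sigma> ?s1"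
    using assms(1) w
    by (intro run_eq[OF run_drop_while[where xs = "map Letter ?v" and ys = "map Letter ?z"]])
      (auto dest: set_takeWhileD)
  have 2: "run (Cond (\<lambda>t. t 4 = Letter LBar)
       (Seq (Pop 4) (Seq (move_while (- {Blank}) 4 8) (push 8 (\<lambda>_. Sep)))) Skip)
      (6 * length ?z + 10) ?s1 (\<sigma>(4 := [], 8 := rev (enc_queries (final_query w)) @ \<sigma> 8))"
  proof (cases "LBar \<in> set w")
    case True
    have a: "set (after_bar w) \<subseteq> \<Sigma>" using set_after_bar[of w] assms(2) by blast
    have "run (Seq (Pop 4) (Seq (move_while (- {Blank}) 4 8) (push 8 (\<lambda>_. Sep))))
        (6 * length ?z + 9) ?s1 (\<sigma>(4 := [], 8 := rev (enc_queries (final_query w)) @ \<sigma> 8))"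
      using True letters_in[OF a] z
      by (intro run_seq[OF run_Pop run_seq[OF run_move_all run_eq[OF run_push[where s = Sep]] lessI]])
        (auto simp: fun_eq_iff final_query_def symbols_eq)
    then show ?thesis
      using True z by (intro run_mono[OF run_Cond_True]) (auto simp: tops_def)
  next
    case False
    then have "tops ?s1 4 \<noteq> Letter LBar" by (simp add: tops_def z)
    from run_Cond_False[where P = "\<lambda>t. t 4 = Letter LBar", OF this run_Skip] show ?thesis
      by (rule run_eq) (use False in \<open>auto simp: z final_query_def\<close>)
  qed
  show ?thesis
    unfolding final_cmd_def by (rule run_seq[OF 1 2]) (use len in simp)
qed

lemma run_app_cmd:
  assumes "\<sigma> 3 = map Letter u" and "\<sigma> i = map Letter s" and "i \<in> {1, 2}"
    and "\<sigma> 4 = []" and "\<sigma> 5 = []" and "\<sigma> 6 = []" and "\<sigma> 7 = []"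
    and "set u \<subseteq> \<Sigma>" and "set s \<subseteq> \<Sigma>" and "length u + length s \<le> M"
  shows "run (app_cmd c a i) (length u * (300 * (length a + 1) * (M + 2)\<^sup>2) + 1) \<sigma>
    (\<sigma>(3 := [], 8 := rev (enc_queries (app_queries c a s u)) @ \<sigma> 8))"
  using assms
proof (induction u arbitrary: \<sigma>)
  case Nil
  then show ?case
    unfolding app_cmd_def by (intro run_eq[OF run_Loop_False]) (auto simp: tops_def)
next
  case (Cons x r)
  let ?B = "300 * (length a + 1) * (M + 2)\<^sup>2"
  let ?w = "r @ LBar # s"
  let ?q = "if x = LCon c then final_query (fold assign_next a ?w) else []"
  let ?s' = "\<sigma>(3 := map Letter r, 8 := rev (enc_queries ?q) @ \<sigma> 8)"
  let ?body = "Seq (Pop 3) (Seq (copy i 4 7) (Seq (push 4 (\<lambda>_. Letter LBar)) (Seq (copy 3 4 7)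
       (Seq (assigns_cmd a) final_cmd))))"
  have i: "i < 9" "i \<noteq> 3" "i \<noteq> 4" "i \<noteq> 5" "i \<noteq> 6" "i \<noteq> 7" "i \<noteq> 8" using Cons.prems(3) by auto
  have in_\<Sigma>: "set r \<subseteq> \<Sigma>" "set s \<subseteq> \<Sigma>" "set ?w \<subseteq> \<Sigma>"
    using Cons.prems special_letters by auto
  have wl: "length ?w \<le> M" using Cons.prems by simp
  have fw: "set (fold assign_next a ?w) \<subseteq> \<Sigma>"
    using set_fold_assign_next[of a ?w] in_\<Sigma>(3) special_letters by blast
  have fl: "length (fold assign_next a ?w) \<le> M"
    using length_fold_assign_next wl by (rule order_trans)
  have M2: "M + 2 \<le> (M + 2)\<^sup>2" by (simp add: power2_eq_square)
  \<comment> \<open>The first summand is for the assignments; the copies, the bar, the final query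
    and the control steps share \<open>50 * M + 50\<close>.\<close>
  have B: "length a * (100 * (M + 1)\<^sup>2 + 1) + 50 * M + 50 \<le> 200 * (length a + 1) * (M + 2)\<^sup>2"
  proof -
    have "100 * (M + 1)\<^sup>2 + 1 \<le> 200 * (M + 2)\<^sup>2" by (simp add: power2_eq_square)
    then have "length a * (100 * (M + 1)\<^sup>2 + 1) \<le> length a * (200 * (M + 2)\<^sup>2)" by (rule mult_le_mono2)
    moreover have "50 * M + 50 \<le> 200 * (M + 2)\<^sup>2" using M2 by linarith
    ultimately show ?thesis by (simp add: algebra_simps)
  qed
  have body: "run ?body (200 * (length a + 1) * (M + 2)\<^sup>2) \<sigma> ?s'" if x: "x = LCon c"
  proof -
    have 1: "run (Pop 3) 1 \<sigma> (\<sigma>(3 := map Letter r))"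
      using Cons.prems by (intro run_eq[OF run_Pop]) auto
    have 2: "run (copy i 4 7) (20 * length s + 5) (\<sigma>(3 := map Letter r))
        (\<sigma>(3 := map Letter r, 4 := map Letter s))"
      using Cons.prems i letters_in[OF in_\<Sigma>(2)]
      by (intro run_eq[OF run_copy]) (auto simp: fun_eq_iff)
    have 3: "run (push 4 (\<lambda>_. Letter LBar)) 3 (\<sigma>(3 := map Letter r, 4 := map Letter s))
        (\<sigma>(3 := map Letter r, 4 := map Letter (LBar # s)))"
      using special_letters by (intro run_eq[OF run_push[where s = "Letter LBar"]]) auto
    have 4: "run (copy 3 4 7) (20 * length r + 5) (\<sigma>(3 := map Letter r, 4 := map Letter (LBar # s)))
        (\<sigma>(3 := map Letter r, 4 := map Letter ?w))"
      using Cons.prems letters_in[OF in_\<Sigma>(1)]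
      by (intro run_eq[OF run_copy]) (auto simp: fun_eq_iff)
    have 5: "run (assigns_cmd a) (length a * (100 * (M + 1)\<^sup>2 + 1) + 1)
        (\<sigma>(3 := map Letter r, 4 := map Letter ?w))
        (\<sigma>(3 := map Letter r, 4 := map Letter (fold assign_next a ?w)))"
      using Cons.prems in_\<Sigma> wl by (intro run_eq[OF run_assigns_cmd[where w = ?w]]) auto
    have 6: "run final_cmd (10 * M + 20) (\<sigma>(3 := map Letter r, 4 := map Letter (fold assign_next a ?w))) ?s'"
      using fw fl Cons.prems x
      by (intro run_eq[OF run_final_cmd[where w = "fold assign_next a ?w"]]) (auto simp: fun_eq_iff)
    have t: "20 * length s + 20 * length r \<le> 20 * M" using Cons.prems by simp
    show ?thesis
      by (rule run_seq[OF 1 run_seq[OF 2 run_seq[OF 3 run_seq[OF 4 run_seq[OF 5 6 lessI] lessI] lessI] lessI]])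
        (use B t in simp)
  qed
  have step: "run (Cond (\<lambda>t. t 3 = Letter (LCon c)) ?body (Pop 3))
      (200 * (length a + 1) * (M + 2)\<^sup>2 + 1) \<sigma> ?s'"
  proof (rule run_cond)
    assume "tops \<sigma> 3 = Letter (LCon c)"
    then show "run ?body (200 * (length a + 1) * (M + 2)\<^sup>2) \<sigma> ?s'"
      using Cons.prems(1) by (intro body) (simp add: tops_def)
  next
    assume "tops \<sigma> 3 \<noteq> Letter (LCon c)"
    then show "run (Pop 3) (200 * (length a + 1) * (M + 2)\<^sup>2) \<sigma> ?s'"
      using Cons.prems(1) M2 by (intro run_eq[OF run_Pop]) (auto simp: tops_def fun_eq_iff)
  qed simp
  have rest: "run (app_cmd c a i) (length r * ?B + 1) ?s'
      (\<sigma>(3 := [], 8 := rev (enc_queries (app_queries c a s (x # r))) @ \<sigma> 8))"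
    using Cons.prems i by (intro run_eq[OF Cons.IH]) (auto simp: fun_eq_iff)
  have "(length a + 1) * (M + 2)\<^sup>2 \<ge> 1" by (simp add: Suc_le_eq)
  \<comment> \<open>A budget of 300 instead of 200 units per letter leaves room for the test and the
    loop.\<close>
  then have "200 * (length a + 1) * (M + 2)\<^sup>2 + 1 < ?B" unfolding mult.assoc by linarith
  then have time: "200 * (length a + 1) * (M + 2)\<^sup>2 + 1 + (length r * ?B + 1) < length (x # r) * ?B + 1"
    by (simp only: list.size add_Suc_right add_0_right mult_Suc)
  show ?case
    unfolding app_cmd_def
    by (rule run_loop_step[OF _ step rest[unfolded app_cmd_def] time])
      (simp add: Cons.prems(1) tops_def)
qed

lemma run_pair_cmd:
  assumes "\<sigma> 1 = map Letter (takeWhile (\<lambda>x. x \<noteq> LBar) w)" and "\<sigma> 2 = map Letter (after_bar w)"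
    and "\<sigma> 3 = []" "\<sigma> 4 = []" and "\<sigma> 5 = []" and "\<sigma> 6 = []" and "\<sigma> 7 = []"
    and "set w \<subseteq> \<Sigma>"
  shows "run (pair_cmd (c, a)) (700 * (length a + 1) * (length w + 2) ^ 3) \<sigma>
    (\<sigma>(8 := rev (enc_queries (pair_queries (c, a) w)) @ \<sigma> 8))"
proof -
  let ?s = "takeWhile (\<lambda>x. x \<noteq> LBar) w" and ?u = "after_bar w" and ?n = "length w"
  have su: "set ?s \<subseteq> \<Sigma>" "set ?u \<subseteq> \<Sigma>"
    using assms(8) set_after_bar[of w] by (auto dest: set_takeWhileD)
  have "length ?s + length (dropWhile (\<lambda>x. x \<noteq> LBar) w) = length w"
    by (metis length_append takeWhile_dropWhile_id)
  then have len: "length ?s + length ?u \<le> ?n" by (simp add: after_bar_def)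
  let ?Q = "300 * (length a + 1) * (?n + 2)\<^sup>2"
  let ?o1 = "rev (enc_queries (app_queries c a ?s ?u)) @ \<sigma> 8"
  have 1: "run (copy 2 3 7) (20 * length ?u + 5) \<sigma> (\<sigma>(3 := map Letter ?u))"
    using assms letters_in[OF su(2)] by (intro run_eq[OF run_copy]) auto
  have 2: "run (app_cmd c a 1) (length ?u * ?Q + 1) (\<sigma>(3 := map Letter ?u)) (\<sigma>(8 := ?o1))"
    using assms su len by (intro run_eq[OF run_app_cmd[where s = ?s and M = ?n]]) (auto simp: fun_eq_iff)
  have 3: "run (copy 1 3 7) (20 * length ?s + 5) (\<sigma>(8 := ?o1)) (\<sigma>(3 := map Letter ?s, 8 := ?o1))"
    using assms letters_in[OF su(1)] by (intro run_eq[OF run_copy]) (auto simp: fun_eq_iff)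
  have 4: "run (app_cmd c a 2) (length ?s * ?Q + 1) (\<sigma>(3 := map Letter ?s, 8 := ?o1))
      (\<sigma>(8 := rev (enc_queries (pair_queries (c, a) w)) @ \<sigma> 8))"
    using assms su len
    by (intro run_eq[OF run_app_cmd[where s = ?u and M = ?n]])
      (auto simp: fun_eq_iff pair_queries_def Let_def)
  \<comment> \<open>The two lists together are no longer than the input, so both searches share the
    budget \<open>?n * ?Q\<close>.\<close>
  have "length ?u * ?Q + length ?s * ?Q \<le> ?n * ?Q"
    using len by (simp add: add_mult_distrib[symmetric] add.commute)
  also have "\<dots> \<le> 300 * (length a + 1) * (?n + 2) ^ 3"
  proof -
    have "?n * (?n + 2)\<^sup>2 \<le> (?n + 2) * (?n + 2)\<^sup>2" by (rule mult_le_mono1) simp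
    also have "\<dots> = (?n + 2) ^ 3" by (simp only: power3_eq_cube power2_eq_square mult.assoc)
    finally have "300 * (length a + 1) * (?n * (?n + 2)\<^sup>2) \<le> 300 * (length a + 1) * (?n + 2) ^ 3"
      by (rule mult_le_mono2)
    then show ?thesis by (simp only: mult.left_commute)
  qed
  finally have Q: "length ?u * ?Q + length ?s * ?Q \<le> 300 * ((length a + 1) * (?n + 2) ^ 3)"
    by (simp only: mult.assoc)
  have "?n + 2 \<le> (?n + 2) ^ 3" by (rule self_le_power) auto
  also have "\<dots> \<le> (length a + 1) * (?n + 2) ^ 3" by simp
  finally have e: "?n + 2 \<le> (length a + 1) * (?n + 2) ^ 3" .
  have "20 * x + 5 + Suc (x * q + 1 + Suc (20 * y + 5 + (y * q + 1))) < 700 * e"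
    if "x * q + y * q \<le> 300 * e" "n + 2 \<le> e" "y + x \<le> n" for x y q e n :: nat
    using that by linarith
  from this[OF Q e len] show ?thesis
    unfolding pair_cmd_def prod.case mult.assoc[of 700]
    by (rule run_seq[OF 1 run_seq[OF 2 run_seq[OF 3 4 lessI] lessI]])
qed

lemma run_pairs_cmd:
  assumes "\<sigma> 1 = map Letter (takeWhile (\<lambda>x. x \<noteq> LBar) w)" and "\<sigma> 2 = map Letter (after_bar w)"
    and "\<sigma> 3 = []" and "\<sigma> 4 = []" and "\<sigma> 5 = []" and "\<sigma> 6 = []" and "\<sigma> 7 = []"
    and "set w \<subseteq> \<Sigma>" and "\<forall>(c, a) \<in> set cas. length a \<le> A"
  shows "run (pairs_cmd cas) (length cas * (700 * (A + 1) * (length w + 2) ^ 3 + 1) + 1) \<sigma>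
    (\<sigma>(8 := rev (enc_queries (tt_queries cas w)) @ \<sigma> 8))"
  using assms
proof (induction cas arbitrary: \<sigma>)
  case Nil
  then show ?case by (intro run_eq[OF run_Skip[folded pairs_cmd.simps(1)]]) (auto simp: tt_queries_def)
next
  case (Cons ca cas)
  obtain c a where ca: "ca = (c, a)" by fastforce
  let ?s = "\<sigma>(8 := rev (enc_queries (pair_queries ca w)) @ \<sigma> 8)"
  have 1: "run (pair_cmd ca) (700 * (A + 1) * (length w + 2) ^ 3) \<sigma> ?s"
    using Cons.prems ca by (auto intro!: run_mono[OF run_pair_cmd])
  have 2: "run (pairs_cmd cas) (length cas * (700 * (A + 1) * (length w + 2) ^ 3 + 1) + 1) ?s
      (\<sigma>(8 := rev (enc_queries (tt_queries (ca # cas) w)) @ \<sigma> 8))"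
    using Cons.prems by (intro run_eq[OF Cons.IH]) (auto simp: tt_queries_def)
  show ?case unfolding pairs_cmd.simps by (rule run_seq[OF 1 2]) simp
qed

lemma run_split_cmd:
  assumes "set w \<subseteq> \<Sigma>"
  shows "run split_cmd (30 * length w + 30) ((\<lambda>_. [])(0 := map Letter w))
    ((\<lambda>_. [])(1 := map Letter (takeWhile (\<lambda>x. x \<noteq> LBar) w), 2 := map Letter (after_bar w)))"
proof -
  let ?s = "takeWhile (\<lambda>x. x \<noteq> LBar) w" and ?z = "dropWhile (\<lambda>x. x \<noteq> LBar) w"
  let ?u = "after_bar w"
  have w: "map Letter w = map Letter ?s @ map Letter ?z"
    by (metis map_append takeWhile_dropWhile_id)
  have su: "set ?s \<subseteq> \<Sigma>" "set ?u \<subseteq> \<Sigma>"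
    using assms set_after_bar[of w] by (auto dest: set_takeWhileD)
  have "length ?s + length ?z = length w"
    by (metis length_append takeWhile_dropWhile_id)
  then have len: "length ?s + length ?u \<le> length w" by (simp add: after_bar_def)
  have top: "top_sym (map Letter ?z) \<in> {Blank, Letter LBar}"
    unfolding drop_to_bar by simp
  let ?e = "\<lambda>_ :: nat. [] :: letter symbol list"
  have 1: "run (move_while (- {Blank, Letter LBar}) 0 7) (6 * length ?s + 1) (?e(0 := map Letter w))
      (?e(0 := map Letter ?z, 7 := rev (map Letter ?s)))"
    using w top su(1)
    by (intro run_eq[OF run_move_while[where xs = "map Letter ?s" and ys = "map Letter ?z"]])
      (auto dest: set_takeWhileD)
  have 2: "run (Pop 0) 1 (?e(0 := map Letter ?z, 7 := rev (map Letter ?s)))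
      (?e(0 := map Letter ?u, 7 := rev (map Letter ?s)))"
    by (intro run_eq[OF run_Pop]) (auto simp: after_bar_def map_tl fun_eq_iff)
  have 3: "run (move_while (- {Blank}) 7 1) (6 * length ?s + 1)
      (?e(0 := map Letter ?u, 7 := rev (map Letter ?s))) (?e(0 := map Letter ?u, 1 := map Letter ?s))"
    using letters_in[OF su(1)] by (intro run_eq[OF run_move_all]) (auto simp: fun_eq_iff)
  have 4: "run (move_while (- {Blank}) 0 7) (6 * length ?u + 1)
      (?e(0 := map Letter ?u, 1 := map Letter ?s)) (?e(1 := map Letter ?s, 7 := rev (map Letter ?u)))"
    using letters_in[OF su(2)] by (intro run_eq[OF run_move_all]) (auto simp: fun_eq_iff)
  have 5: "run (move_while (- {Blank}) 7 2) (6 * length ?u + 1)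
      (?e(1 := map Letter ?s, 7 := rev (map Letter ?u))) (?e(1 := map Letter ?s, 2 := map Letter ?u))"
    using letters_in[OF su(2)] by (intro run_eq[OF run_move_all]) (auto simp: fun_eq_iff)
  show ?thesis
    unfolding split_cmd_def
    by (rule run_seq[OF 1 run_seq[OF 2 run_seq[OF 3 run_seq[OF 4 5 lessI] lessI] lessI]])
      (use len in simp)
qed

lemma run_tt_cmd:
  assumes "set w \<subseteq> \<Sigma>" and "\<forall>(c, a) \<in> set cas. length a \<le> A"
  shows "\<exists>\<sigma>. run (tt_cmd cas) (10000 * (length cas + 1) * (A + 1) * (length w + 1) ^ 3)
      ((\<lambda>_. [])(0 := map Letter w)) \<sigma> \<and> \<sigma> 0 = enc_queries (tt_queries cas w)"
proof -
  let ?n = "length w" and ?out = "enc_queries (tt_queries cas w)"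
  let ?\<sigma> = "(\<lambda>_. [])(1 := map Letter (takeWhile (\<lambda>x. x \<noteq> LBar) w), 2 := map Letter (after_bar w))"
  have 2: "run (pairs_cmd cas) (length cas * (700 * (A + 1) * (?n + 2) ^ 3 + 1) + 1) ?\<sigma>
      (?\<sigma>(8 := rev ?out))"
    using assms by (intro run_eq[OF run_pairs_cmd]) auto
  have "set (tt_queries cas w) \<subseteq> lists \<Sigma>"
    using assms special_letters by (intro tt_queries_lists) auto
  then have "set ?out \<subseteq> insert Sep (Letter ` \<Sigma>)" by (rule set_enc_queries)
  then have "set ?out \<subseteq> \<Gamma> - {Blank}" by (auto simp: symbols_eq)
  then have 3: "run (move_while (- {Blank}) 8 0) (6 * length ?out + 1) (?\<sigma>(8 := rev ?out)) (?\<sigma>(0 := ?out))"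
    by (intro run_eq[OF run_move_all]) (auto simp: fun_eq_iff)
  define L where "L = length cas"
  define C where "C = (?n + 1) ^ 3"
  \<comment> \<open>All contributions to the time are bounded by multiples of \<open>P\<close>,
    which makes the final comparison linear.\<close>
  define P where "P = (L + 1) * (A + 1) * C"
  \<comment> \<open>Passing from \<open>?n + 2\<close> to \<open>2 * (?n + 1)\<close> costs a factor
    8; the resulting 8 * 700 = 5600 is the dominant part of the constant 10000.\<close>
  have "(?n + 2) ^ 3 \<le> (2 * (?n + 1)) ^ 3" by (rule power_mono) auto
  then have cube: "(?n + 2) ^ 3 \<le> 8 * C" unfolding C_def power_mult_distrib by simp
  have nC: "?n + 1 \<le> C" unfolding C_def by (rule self_le_power) auto
  have "?n * (?n + 2) \<le> (?n + 1) ^ 2" by (simp add: power2_eq_square)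
  also have "\<dots> \<le> C" unfolding C_def by (rule power_increasing) auto
  finally have sq: "?n * (?n + 2) \<le> C" .
  have P: "P = L * ((A + 1) * C) + (A + 1) * C" "(A + 1) * C = A * C + C"
    by (simp_all add: P_def algebra_simps)
  have "L * (700 * (A + 1) * (?n + 2) ^ 3) \<le> L * (700 * (A + 1) * (8 * C))"
    using cube by (intro mult_le_mono2)
  also have "\<dots> = 5600 * (L * ((A + 1) * C))" by (simp add: algebra_simps)
  also have "\<dots> \<le> 5600 * P" using P by simp
  finally have t1: "L * (700 * (A + 1) * (?n + 2) ^ 3) \<le> 5600 * P" .
  have "L * C \<le> L * ((A + 1) * C)" by (intro mult_le_mono2) simp
  then have LC: "L * C \<le> P" using P(1) by linarith
  have "L \<le> L * C" using nC by simp
  then have LP: "L \<le> P" using LC by linarith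
  have CP: "C \<le> P" using P by linarith
  have "length ?out \<le> L * (?n * (?n + 2))" unfolding L_def by (rule length_tt_queries)
  also have "\<dots> \<le> L * C" using sq by (rule mult_le_mono2)
  finally have out: "length ?out \<le> P" using LC by linarith
  have "length cas * (700 * (A + 1) * (?n + 2) ^ 3 + 1) = L * (700 * (A + 1) * (?n + 2) ^ 3) + L"
    by (simp only: L_def add_mult_distrib2 mult_1_right)
  moreover have "10000 * (length cas + 1) * (A + 1) * (?n + 1) ^ 3 = 10000 * P"
    by (simp only: P_def L_def C_def mult.assoc)
  ultimately have T: "30 * ?n + 30 + (length cas * (700 * (A + 1) * (?n + 2) ^ 3 + 1) + 1) + 6 * length ?out + 10
      \<le> 10000 * (length cas + 1) * (A + 1) * (?n + 1) ^ 3"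
    using t1 LP CP nC out by linarith
  have "run (tt_cmd cas) (10000 * (length cas + 1) * (A + 1) * (?n + 1) ^ 3)
      ((\<lambda>_. [])(0 := map Letter w)) (?\<sigma>(0 := ?out))"
    unfolding tt_cmd_def
    by (rule run_seq[OF run_split_cmd[OF assms(1)] run_seq[OF 2 3 lessI]]) (use T in linarith)
  then show ?thesis by (intro exI[of _ "?\<sigma>(0 := ?out)"]) simp
qed

end

section \<open>Polynomial time for generator and evaluator, and the reduction\<close>

lemma tt_queries_poly_time_computable:
  assumes "finite \<Sigma>" and "LVar \<in> \<Sigma>" and "LBar \<in> \<Sigma>" and "range LConst \<subseteq> \<Sigma>"
  shows "poly_time_computable (lists \<Sigma>) enc_word enc_queries (tt_queries cas)"
proof -
  interpret query_machine "insert Blank (insert Sep (Letter ` \<Sigma>))" \<Sigma>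
    by standard (use assms in auto)
  \<comment> \<open>A common bound on the lengths of the tuples; it depends on \<open>cas\<close>
    only and so enters the time bound as a constant.\<close>
  define A where "A = sum_list (map (length \<circ> snd) cas)"
  have A: "\<forall>(c, a) \<in> set cas. length a \<le> A"
    unfolding A_def by (force intro!: member_le_sum_list)
  show ?thesis
  proof (rule run_poly_time_computable)
    fix w assume w: "w \<in> lists \<Sigma>"
    then show "set (enc_word w) \<subseteq> insert Blank (insert Sep (Letter ` \<Sigma>)) - {Blank}"
      by (auto simp: enc_word_def)
    have "Blank \<notin> set (enc_queries (tt_queries cas w))"
      by (auto simp: enc_queries_def enc_word_def)
    then show "\<exists>\<sigma>. run (tt_cmd cas) (10000 * (length cas + 1) * (A + 1) * (length (enc_word w) + 1) ^ 3)
        ((\<lambda>_. [])(0 := enc_word w)) \<sigma> \<and> \<sigma> 0 = enc_queries (tt_queries cas w) \<and>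
        Blank \<notin> set (enc_queries (tt_queries cas w))"
      using run_tt_cmd[OF _ A, of w] w by (auto simp: enc_word_def)
  qed
qed

lemma verdict_poly_time_computable:
  assumes "finite \<C>"
  shows "poly_time_computable (lists (alphabet \<C>) \<times> UNIV) enc_answers enc_verdict verdict"
proof -
  \<comment> \<open>The sum of the arities bounds the counter of missing arguments, which makes the
    set of states finite.\<close>
  define N where "N = sum arity \<C>"
  define Q :: "eval_state set" where "Q = insert None (Some ` ({..2} \<times> {..N} \<times> UNIV))"
  define \<Delta> :: "letter symbol set" where "\<Delta> = insert Sep (Letter ` alphabet \<C> \<union> range Bit)"
  have arity: "arity c \<le> N" if "c \<in> \<C>" for c
    unfolding N_def using that assms by (intro member_le_sum) auto
  have "eval_step q s \<in> Q" if "q \<in> Q" "s \<in> \<Delta>" for q s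
    using that arity
    by (cases "(q, s)" rule: eval_step.cases) (auto simp: Q_def \<Delta>_def alphabet_def)
  moreover have "finite \<Delta>" using assms by (simp add: \<Delta>_def alphabet_def)
  moreover have "set (enc_answers x) \<subseteq> \<Delta>" if "x \<in> lists (alphabet \<C>) \<times> UNIV" for x
    using that by (auto simp: \<Delta>_def enc_answers_def enc_word_def)
  ultimately have "poly_time_computable (lists (alphabet \<C>) \<times> UNIV) enc_answers enc_verdict
      (\<lambda>x. (\<lambda>q. q \<noteq> None) (foldl eval_step (Some (0, 0, False)) (enc_answers x)))"
    by (intro dfa_poly_time_computable[where Q = Q and \<Delta> = \<Delta>]) (auto simp: Q_def \<Delta>_def)
  then show ?thesis by (simp add: verdict_def[abs_def])
qed

theorem theorem7:
  fixes \<C> :: "con set"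
  assumes "finite \<C>"
  shows "poly_tt_reducible (alphabet \<C>) (EQUIV_c \<C>) (CSP_c \<C>)"
proof -
  let ?S = "{(c, a). c \<in> \<C> \<and> length a = arity c \<and> \<not> eval_con c a}"
  \<comment> \<open>There are finitely many constraints and finitely many Boolean tuples of each
    arity. The list \<open>cas\<close> is thus a constant of the reduction, although its length may
    be exponential in the arities.\<close>
  have "?S \<subseteq> (SIGMA c : \<C>. {a. set a \<subseteq> UNIV \<and> length a = arity c})" by auto
  moreover have "finite (SIGMA c : \<C>. {a :: bool list. set a \<subseteq> UNIV \<and> length a = arity c})"
    by (intro finite_SigmaI assms finite_lists_length_eq) simp
  ultimately have "finite ?S" by (rule finite_subset)
  then obtain cas where cas: "set cas = ?S" using finite_list by blast
  have \<Sigma>: "finite (alphabet \<C>)" "LVar \<in> alphabet \<C>" "LBar \<in> alphabet \<C>"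
    "range LConst \<subseteq> alphabet \<C>"
    using assms by (auto simp: alphabet_def)
  show ?thesis
    unfolding poly_tt_reducible_def
  proof (intro exI conjI ballI)
    show "tt_queries cas ` lists (alphabet \<C>) \<subseteq> lists (lists (alphabet \<C>))"
    proof (rule image_subsetI)
      fix w assume "w \<in> lists (alphabet \<C>)"
      then have "set w \<subseteq> alphabet \<C>" by auto
      from tt_queries_lists[OF this \<Sigma>(4,3)]
      show "tt_queries cas w \<in> lists (lists (alphabet \<C>))" by (intro in_listsI) blast
    qed
    show "poly_time_computable (lists (alphabet \<C>)) enc_word enc_queries (tt_queries cas)"
      by (rule tt_queries_poly_time_computable[OF \<Sigma>])
    show "poly_time_computable (lists (alphabet \<C>) \<times> UNIV) enc_answers enc_verdict verdict"
      by (rule verdict_poly_time_computable[OF assms])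
    fix x assume "x \<in> lists (alphabet \<C>)"
    then show "x \<in> EQUIV_c \<C> \<longleftrightarrow> verdict (x, map (\<lambda>y. y \<in> CSP_c \<C>) (tt_queries cas x))"
      by (intro tt_queries_reduce[OF cas]) auto
  qed
qed

end
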